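(* There is a pushout square of algebraic theories: the square with top morphism $\mathrm{can}\colon\mathbf{Perm}\to\mathbf{Rack}$, left morphism $\mathrm{id}\colon\mathbf{Perm}\to\mathbf{Sets}$, right morphism ${\supset}\colon\mathbf{Rack}\to\mathbf{Quan}$, and bottom morphism the structure morphism $\mathbf{Sets}\to\mathbf{Quan}$ commutes and exhibits $\mathbf{Quan}$ as the pushout, in the category of algebraic theories, of \[ \mathbf{Sets}\xleftarrow{\ \mathrm{id}\ }\mathbf{Perm}\xrightarrow{\ \mathrm{can}\ }\mathbf{Rack}. \]
   Context: A rack $(R,\rhd)$ is a set $R$ with a binary operation $\rhd$ such that for every $x\in R$ the left multiplication $y\mapsto x\rhd y$ is bijective and $x\rhd(y\rhd z)=(x\rhd y)\rhd(x\rhd z)$ for all $y,z\in R$. Its canonical automorphism is $\mathrm{F}(x)=x\rhd x$ (this is a rack automorphism). A quandle is a rack with $\mathrm{F}=\mathrm{id}$, i.e. $x\rhd x=x$ for all $x$. A permutation is a pair $(S,f)$ of a set $S$ and a bijection $f\colon S\to S$; a morphism $(S,f)\to(T,g)$ is a map $\phi$ with $\phi f=g\phi$. $\mathbf{Sets},\mathbf{Perm},\mathbf{Rack},\mathbf{Quan}$ denote both the algebraic (Lawvere) theories of sets, permutations, racks, quandles and their categories of models. A morphism of algebraic theories $\mathbf{T}\to\mathbf{T}'$ is written in the direction of the left adjoint; it is the same as a ('forgetful', right-adjoint) functor from $\mathbf{T}'$-models to $\mathbf{T}$-models commuting with the underlying-set functors. The morphisms are given by their right adjoints: $\mathrm{can}$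 by $(R,\rhd)\mapsto(R,\mathrm{F})$; $\mathrm{id}\colon\mathbf{Perm}\to\mathbf{Sets}$ by $S\mapsto(S,\mathrm{id}_S)$; $\supset$ by the inclusion of quandles into racks; the structure morphism $\mathbf{Sets}\to\mathbf{T}$ of a theory $\mathbf{T}$ by the underlying-set functor. *)

theory Defs
  imports Main
begin

section \<open>Algebraic theories\<close>

text \<open>
  An algebraic (Lawvere) theory is a category whose objects are the natural numbers and in which
  the object \<open>n\<close> is the \<open>n\<close>-fold power of the object \<open>1\<close>, with chosen projections.
  \<open>Comp T m n k g f\<close> is the composite of \<open>f : m \<rightarrow> n\<close> and \<open>g : n \<rightarrow> k\<close>; the objects are passed
  explicitly because the hom-sets need not be disjoint.
\<close>

record 'o lawvere =
  Hom :: "nat \<Rightarrow> nat \<Rightarrow> 'o set"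
  Ident :: "nat \<Rightarrow> 'o"
  Comp :: "nat \<Rightarrow> nat \<Rightarrow> nat \<Rightarrow> 'o \<Rightarrow> 'o \<Rightarrow> 'o"
  Proj :: "nat \<Rightarrow> nat \<Rightarrow> 'o"

locale lawvere_theory =
  fixes T :: "'o lawvere"
  assumes Ident_closed: "Ident T n \<in> Hom T n n"
    and Comp_closed: "\<lbrakk>f \<in> Hom T m n; g \<in> Hom T n k\<rbrakk> \<Longrightarrow> Comp T m n k g f \<in> Hom T m k"
    and Comp_Ident: "f \<in> Hom T m n \<Longrightarrow> Comp T m m n f (Ident T m) = f"
    and Ident_Comp: "f \<in> Hom T m n \<Longrightarrow> Comp T m n n (Ident T n) f = f"
    and Comp_assoc: "\<lbrakk>f \<in> Hom T m n; g \<in> Hom T n k; h \<in> Hom T k l\<rbrakk>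
      \<Longrightarrow> Comp T m k l h (Comp T m n k g f) = Comp T m n l (Comp T n k l h g) f"
    and Proj_closed: "i < n \<Longrightarrow> Proj T n i \<in> Hom T n 1"
    and Proj_1: "Proj T 1 0 = Ident T 1"
    and tupling: "(\<And>i. i < n \<Longrightarrow> F i \<in> Hom T m 1)
      \<Longrightarrow> \<exists>!g. g \<in> Hom T m n \<and> (\<forall>i<n. Comp T m n 1 (Proj T n i) g = F i)"

text \<open>
  A morphism of theories is a functor that is the identity on objects and preserves the
  chosen projections. Such functors are only determined on the hom-sets, so equality of
  morphisms is agreement on the hom-sets.
\<close>

type_synonym ('o, 'p) tmap = "nat \<Rightarrow> nat \<Rightarrow> 'o \<Rightarrow> 'p"

definition theory_morphism :: "'o lawvere \<Rightarrow> 'p lawvere \<Rightarrow> ('o, 'p) tmap \<Rightarrow> bool" where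
  "theory_morphism T T' \<phi> \<longleftrightarrow>
     (\<forall>m n. \<forall>f \<in> Hom T m n. \<phi> m n f \<in> Hom T' m n) \<and>
     (\<forall>n. \<phi> n n (Ident T n) = Ident T' n) \<and>
     (\<forall>m n k. \<forall>f \<in> Hom T m n. \<forall>g \<in> Hom T n k.
        \<phi> m k (Comp T m n k g f) = Comp T' m n k (\<phi> n k g) (\<phi> m n f)) \<and>
     (\<forall>n. \<forall>i<n. \<phi> n 1 (Proj T n i) = Proj T' n i)"

definition tmap_comp :: "('p, 'q) tmap \<Rightarrow> ('o, 'p) tmap \<Rightarrow> ('o, 'q) tmap" (infixl "\<circ>\<circ>" 55) where
  "(\<psi> \<circ>\<circ> \<phi>) m n f = \<psi> m n (\<phi> m n f)"

definition tmap_eq :: "'o lawvere \<Rightarrow> ('o, 'p) tmap \<Rightarrow> ('o, 'p) tmap \<Rightarrow> bool" where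
  "tmap_eq T \<phi> \<psi> \<longleftrightarrow> (\<forall>m n. \<forall>f \<in> Hom T m n. \<phi> m n f = \<psi> m n f)"

text \<open>
  Pushout squares in the category of algebraic theories, with \<open>t : A \<rightarrow> B\<close> on top,
  \<open>l : A \<rightarrow> C\<close> on the left, \<open>r : B \<rightarrow> D\<close> on the right and \<open>b : C \<rightarrow> D\<close> at the bottom.
  The universal property is tested against all theories whose morphisms live in the type
  \<open>'x\<close>; since HOL cannot quantify over types inside a formula, \<open>'x\<close> is a parameter, and a
  theorem with a free type variable \<open>'x\<close> covers all theories.
\<close>

definition pushout_square ::
  "'x itself \<Rightarrow> 'a lawvere \<Rightarrow> 'b lawvere \<Rightarrow> 'c lawvere \<Rightarrow> 'd lawvere \<Rightarrow>
   ('a, 'b) tmap \<Rightarrow> ('a, 'c) tmap \<Rightarrow> ('b, 'd) tmap \<Rightarrow> ('c, 'd) tmap \<Rightarrow> bool" where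
  "pushout_square (_ :: 'x itself) A B C D t l r b \<longleftrightarrow>
     lawvere_theory A \<and> lawvere_theory B \<and> lawvere_theory C \<and> lawvere_theory D \<and>
     theory_morphism A B t \<and> theory_morphism A C l \<and>
     theory_morphism B D r \<and> theory_morphism C D b \<and>
     tmap_eq A (r \<circ>\<circ> t) (b \<circ>\<circ> l) \<and>
     (\<forall>(X :: 'x lawvere) u v.
        lawvere_theory X \<and> theory_morphism B X u \<and> theory_morphism C X v \<and>
        tmap_eq A (u \<circ>\<circ> t) (v \<circ>\<circ> l) \<longrightarrow>
        (\<exists>w. theory_morphism D X w \<and> tmap_eq B (w \<circ>\<circ> r) u \<and> tmap_eq C (w \<circ>\<circ> b) v \<and>
           (\<forall>w'. theory_morphism D X w' \<and> tmap_eq B (w' \<circ>\<circ> r) u \<and> tmap_eq C (w' \<circ>\<circ> b) v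
              \<longrightarrow> tmap_eq D w' w)))"


section \<open>Equational presentations and their models\<close>

datatype 'f trm = Var nat | Op 'f "'f trm list"

record 'f presentation =
  symbols :: "'f set"
  arity :: "'f \<Rightarrow> nat"
  equations :: "('f trm \<times> 'f trm) set"

record ('f, 'a) algebra =
  carr :: "'a set"
  interp :: "'f \<Rightarrow> 'a list \<Rightarrow> 'a"

primrec eval :: "('f, 'a) algebra \<Rightarrow> (nat \<Rightarrow> 'a) \<Rightarrow> 'f trm \<Rightarrow> 'a" where
  "eval A \<rho> (Var i) = \<rho> i"
| "eval A \<rho> (Op f ts) = interp A f (map (eval A \<rho>) ts)"

primrec subst :: "(nat \<Rightarrow> 'f trm) \<Rightarrow> 'f trm \<Rightarrow> 'f trm" where
  "subst \<sigma> (Var i) = \<sigma> i"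
| "subst \<sigma> (Op f ts) = Op f (map (subst \<sigma>) ts)"

definition closed_algebra :: "'f presentation \<Rightarrow> ('f, 'a) algebra \<Rightarrow> bool" where
  "closed_algebra P A \<longleftrightarrow> (\<forall>f \<in> symbols P. \<forall>xs. length xs = arity P f \<and> set xs \<subseteq> carr A
      \<longrightarrow> interp A f xs \<in> carr A)"

definition model :: "'f presentation \<Rightarrow> ('f, 'a) algebra \<Rightarrow> bool" where
  "model P A \<longleftrightarrow> closed_algebra P A \<and>
     (\<forall>(s, t) \<in> equations P. \<forall>\<rho>. range \<rho> \<subseteq> carr A \<longrightarrow> eval A \<rho> s = eval A \<rho> t)"

definition model_hom ::
  "'f presentation \<Rightarrow> ('f, 'a) algebra \<Rightarrow> ('f, 'b) algebra \<Rightarrow> ('a \<Rightarrow> 'b) \<Rightarrow> bool" where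
  "model_hom P A B h \<longleftrightarrow> h ` carr A \<subseteq> carr B \<and>
     (\<forall>f \<in> symbols P. \<forall>xs. length xs = arity P f \<and> set xs \<subseteq> carr A
        \<longrightarrow> h (interp A f xs) = interp B f (map h xs))"

inductive_set terms :: "'f presentation \<Rightarrow> nat \<Rightarrow> 'f trm set" for P m where
  Var: "i < m \<Longrightarrow> Var i \<in> terms P m"
| Op: "\<lbrakk>f \<in> symbols P; length ts = arity P f; \<forall>t \<in> set ts. t \<in> terms P m\<rbrakk> \<Longrightarrow> Op f ts \<in> terms P m"

inductive provable :: "'f presentation \<Rightarrow> nat \<Rightarrow> 'f trm \<Rightarrow> 'f trm \<Rightarrow> bool" for P m where
  refl: "t \<in> terms P m \<Longrightarrow> provable P m t t"
| sym: "provable P m s t \<Longrightarrow> provable P m t s"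
| trans: "\<lbrakk>provable P m s t; provable P m t u\<rbrakk> \<Longrightarrow> provable P m s u"
| cong: "\<lbrakk>f \<in> symbols P; length ts = arity P f; list_all2 (provable P m) ts us\<rbrakk>
    \<Longrightarrow> provable P m (Op f ts) (Op f us)"
| ax: "\<lbrakk>(l, r) \<in> equations P; range \<sigma> \<subseteq> terms P m\<rbrakk> \<Longrightarrow> provable P m (subst \<sigma> l) (subst \<sigma> r)"

definition cls :: "'f presentation \<Rightarrow> nat \<Rightarrow> 'f trm \<Rightarrow> 'f trm set" where
  "cls P m t = {s. provable P m t s}"

definition rep :: "'f trm set \<Rightarrow> 'f trm" where
  "rep c = (SOME t. t \<in> c)"

definition free_model :: "'f presentation \<Rightarrow> nat \<Rightarrow> ('f, 'f trm set) algebra" where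
  "free_model P m = \<lparr>carr = cls P m ` terms P m, interp = \<lambda>f cs. cls P m (Op f (map rep cs))\<rparr>"

definition gens :: "'f presentation \<Rightarrow> nat \<Rightarrow> 'f trm set list" where
  "gens P m = map (\<lambda>i. cls P m (Var i)) [0..<m]"

text \<open>
  The theory of \<open>P\<close>: a morphism \<open>m \<rightarrow> n\<close> is an \<open>n\<close>-tuple of \<open>m\<close>-ary terms up to provable
  equality. Such a tuple acts on every model \<open>A\<close> as an operation from \<open>m\<close>-tuples to
  \<open>n\<close>-tuples, and composition in the theory is this action for \<open>A = free_model P m\<close>.
\<close>

definition act :: "('f, 'a) algebra \<Rightarrow> 'f trm set list \<Rightarrow> 'a list \<Rightarrow> 'a list" where
  "act A cs xs = map (\<lambda>c. eval A (\<lambda>i. xs ! i) (rep c)) cs"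

definition theory_of :: "'f presentation \<Rightarrow> 'f trm set list lawvere" where
  "theory_of P =
     \<lparr>Hom = \<lambda>m n. {cs. length cs = n \<and> set cs \<subseteq> carr (free_model P m)},
      Ident = gens P,
      Comp = \<lambda>m n k g f. act (free_model P m) g f,
      Proj = \<lambda>n i. [gens P n ! i]\<rparr>"

text \<open>
  The morphism of theories \<open>theory_of P \<rightarrow> theory_of P'\<close> that corresponds to a functor \<open>G\<close>
  from models of \<open>P'\<close> to models of \<open>P\<close> over the underlying sets: an \<open>m\<close>-ary operation of
  \<open>P\<close> acts on \<open>G (free_model P' m)\<close>, and applying it to the generators yields an element
  of the free model, that is, an \<open>m\<close>-ary operation of \<open>P'\<close>. The lemma
  \<open>act_morphism_of_right_adjoint\<close> below shows that \<open>G\<close> is indeed restriction along this morphism.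
\<close>

definition morphism_of_right_adjoint ::
  "'g presentation \<Rightarrow> (('g, 'g trm set) algebra \<Rightarrow> ('f, 'g trm set) algebra)
   \<Rightarrow> ('f trm set list, 'g trm set list) tmap" where
  "morphism_of_right_adjoint P' G m n f = act (G (free_model P' m)) f (gens P' m)"


section \<open>Sets, permutations, racks and quandles\<close>

definition permutation :: "'a set \<Rightarrow> ('a \<Rightarrow> 'a) \<Rightarrow> bool" where
  "permutation S f \<longleftrightarrow> bij_betw f S S"

definition rack :: "'a set \<Rightarrow> ('a \<Rightarrow> 'a \<Rightarrow> 'a) \<Rightarrow> bool" where
  "rack R tri \<longleftrightarrow> (\<forall>x \<in> R. bij_betw (tri x) R R) \<and>
     (\<forall>x \<in> R. \<forall>y \<in> R. \<forall>z \<in> R. tri x (tri y z) = tri (tri x y) (tri x z))"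

definition canonical :: "('a \<Rightarrow> 'a \<Rightarrow> 'a) \<Rightarrow> 'a \<Rightarrow> 'a" where
  "canonical tri x = tri x x"

definition quandle :: "'a set \<Rightarrow> ('a \<Rightarrow> 'a \<Rightarrow> 'a) \<Rightarrow> bool" where
  "quandle R tri \<longleftrightarrow> rack R tri \<and> (\<forall>x \<in> R. canonical tri x = x)"

text \<open>
  The presentations express bijectivity equationally, by an extra symbol for the inverse.
  The lemmas \<open>model_perm_iff\<close>, \<open>model_rack_iff\<close> and \<open>model_quandle_iff\<close> below show
  that this symbol is no additional structure.
\<close>

definition set_presentation :: "unit presentation" where
  "set_presentation = \<lparr>symbols = {}, arity = \<lambda>_. 0, equations = {}\<rparr>"

datatype perm_symbol = Shift | Unshift

definition perm_presentation :: "perm_symbol presentation" where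
  "perm_presentation =
     \<lparr>symbols = UNIV, arity = \<lambda>_. 1,
      equations = {(Op Shift [Op Unshift [Var 0]], Var 0), (Op Unshift [Op Shift [Var 0]], Var 0)}\<rparr>"

datatype rack_symbol = Tri | Untri

definition rack_equations :: "(rack_symbol trm \<times> rack_symbol trm) set" where
  "rack_equations =
     {(Op Tri [Var 0, Op Untri [Var 0, Var 1]], Var 1),
      (Op Untri [Var 0, Op Tri [Var 0, Var 1]], Var 1),
      (Op Tri [Var 0, Op Tri [Var 1, Var 2]],
       Op Tri [Op Tri [Var 0, Var 1], Op Tri [Var 0, Var 2]])}"

definition rack_presentation :: "rack_symbol presentation" where
  "rack_presentation = \<lparr>symbols = UNIV, arity = \<lambda>_. 2, equations = rack_equations\<rparr>"

definition quandle_presentation :: "rack_symbol presentation" where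
  "quandle_presentation =
     \<lparr>symbols = UNIV, arity = \<lambda>_. 2,
      equations = insert (Op Tri [Var 0, Var 0], Var 0) rack_equations\<rparr>"

abbreviation "Sets \<equiv> theory_of set_presentation"
abbreviation "Perm \<equiv> theory_of perm_presentation"
abbreviation "Rack \<equiv> theory_of rack_presentation"
abbreviation "Quan \<equiv> theory_of quandle_presentation"

definition set_algebra :: "'a set \<Rightarrow> (unit, 'a) algebra" where
  "set_algebra S = \<lparr>carr = S, interp = \<lambda>_ _. undefined\<rparr>"

definition perm_algebra :: "'a set \<Rightarrow> ('a \<Rightarrow> 'a) \<Rightarrow> (perm_symbol, 'a) algebra" where
  "perm_algebra S f =
     \<lparr>carr = S,
      interp = \<lambda>s xs. case s of Shift \<Rightarrow> f (xs ! 0) | Unshift \<Rightarrow> inv_into S f (xs ! 0)\<rparr>"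

definition rack_algebra :: "'a set \<Rightarrow> ('a \<Rightarrow> 'a \<Rightarrow> 'a) \<Rightarrow> (rack_symbol, 'a) algebra" where
  "rack_algebra R tri =
     \<lparr>carr = R,
      interp = \<lambda>s xs. case s of Tri \<Rightarrow> tri (xs ! 0) (xs ! 1)
                                | Untri \<Rightarrow> inv_into R (tri (xs ! 0)) (xs ! 1)\<rparr>"

definition tri_of :: "(rack_symbol, 'a) algebra \<Rightarrow> 'a \<Rightarrow> 'a \<Rightarrow> 'a" where
  "tri_of A x y = interp A Tri [x, y]"

text \<open>The right adjoints, which leave the underlying sets and maps unchanged.\<close>

definition can_functor :: "(rack_symbol, 'a) algebra \<Rightarrow> (perm_symbol, 'a) algebra" where
  "can_functor A = perm_algebra (carr A) (canonical (tri_of A))"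

definition id_functor :: "(unit, 'a) algebra \<Rightarrow> (perm_symbol, 'a) algebra" where
  "id_functor A = perm_algebra (carr A) (\<lambda>x. x)"

definition incl_functor :: "(rack_symbol, 'a) algebra \<Rightarrow> (rack_symbol, 'a) algebra" where
  "incl_functor A = rack_algebra (carr A) (tri_of A)"

definition underlying_functor :: "('f, 'a) algebra \<Rightarrow> (unit, 'a) algebra" where
  "underlying_functor A = set_algebra (carr A)"

definition can_morphism :: "(perm_symbol trm set list, rack_symbol trm set list) tmap" where
  "can_morphism = morphism_of_right_adjoint rack_presentation can_functor"

definition id_morphism :: "(perm_symbol trm set list, unit trm set list) tmap" where
  "id_morphism = morphism_of_right_adjoint set_presentation id_functor"

definition incl_morphism :: "(rack_symbol trm set list, rack_symbol trm set list) tmap" where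
  "incl_morphism = morphism_of_right_adjoint quandle_presentation incl_functor"

definition structure_morphism ::
  "'f presentation \<Rightarrow> (unit trm set list, 'f trm set list) tmap" where
  "structure_morphism P = morphism_of_right_adjoint P underlying_functor"


section \<open>Models of the four theories\<close>

lemma model_set_iff: "model set_presentation A"
  by (simp add: model_def closed_algebra_def set_presentation_def)

lemma model_perm_iff:
  "model perm_presentation A \<longleftrightarrow>
     permutation (carr A) (\<lambda>x. interp A Shift [x]) \<and>
     (\<forall>x \<in> carr A. interp A Unshift [x] = inv_into (carr A) (\<lambda>x. interp A Shift [x]) x)"
  (is "?L \<longleftrightarrow> ?R")
proof
  assume L: ?L
  let ?f = "\<lambda>x. interp A Shift [x]" and ?g = "\<lambda>x. interp A Unshift [x]"
  have cl: "?f x \<in> carr A" "?g x \<in> carr A" if "x \<in> carr A" for x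
    using L that by (auto simp: model_def closed_algebra_def perm_presentation_def)
  have eqs: "?f (?g x) = x" "?g (?f x) = x" if "x \<in> carr A" for x
  proof -
    have "\<forall>(s, t) \<in> equations perm_presentation. eval A (\<lambda>_. x) s = eval A (\<lambda>_. x) t"
      using L that unfolding model_def by fastforce
    then show "?f (?g x) = x" "?g (?f x) = x" by (simp_all add: perm_presentation_def)
  qed
  have b: "bij_betw ?f (carr A) (carr A)"
    by (rule bij_betw_byWitness[where f' = ?g]) (use cl eqs in auto)
  have "?g x = inv_into (carr A) ?f x" if "x \<in> carr A" for x
    by (rule inv_into_f_eq[symmetric])
      (use bij_betw_imp_inj_on[OF b] cl[OF that] eqs that in simp_all)
  with b show ?R by (auto simp: permutation_def)
next
  assume R: ?R
  let ?f = "\<lambda>x. interp A Shift [x]" and ?g = "\<lambda>x. interp A Unshift [x]"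
  from R have b: "bij_betw ?f (carr A) (carr A)" by (simp add: permutation_def)
  have g: "?g x = inv_into (carr A) ?f x" if "x \<in> carr A" for x using R that by blast
  have cl: "?f x \<in> carr A" "?g x \<in> carr A" if "x \<in> carr A" for x
    using b g that by (auto simp: bij_betw_def inv_into_into)
  have eqs: "?f (?g x) = x" "?g (?f x) = x" if "x \<in> carr A" for x
    using bij_betw_inv_into_right[OF b that] bij_betw_inv_into_left[OF b that] g cl that
    by simp_all
  have "interp A s xs \<in> carr A" if "length xs = 1" "set xs \<subseteq> carr A" for s xs
    using that cl by (cases s) (auto simp: length_Suc_conv)
  then show ?L
    unfolding model_def closed_algebra_def using eqs
    by (auto simp: perm_presentation_def image_subset_iff)
qed

lemma binary_closed:
  assumes "length xs = 2" "set xs \<subseteq> carr A"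
    and "\<And>x y. \<lbrakk>x \<in> carr A; y \<in> carr A\<rbrakk> \<Longrightarrow> interp A s [x, y] \<in> carr A"
  shows "interp A s xs \<in> carr A"
  using assms by (auto simp: length_Suc_conv numeral_2_eq_2)

lemma model_rack_iff:
  "model rack_presentation A \<longleftrightarrow>
     rack (carr A) (tri_of A) \<and>
     (\<forall>x \<in> carr A. \<forall>y \<in> carr A. interp A Untri [x, y] = inv_into (carr A) (tri_of A x) y)"
  (is "?L \<longleftrightarrow> ?R")
proof
  assume L: ?L
  let ?g = "\<lambda>x y. interp A Untri [x, y]"
  have cl: "tri_of A x y \<in> carr A" "?g x y \<in> carr A" if "x \<in> carr A" "y \<in> carr A" for x y
    using L that by (auto simp: model_def closed_algebra_def rack_presentation_def tri_of_def)
  have eqs: "tri_of A x (?g x y) = y" "?g x (tri_of A x y) = y"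
    "tri_of A x (tri_of A y z) = tri_of A (tri_of A x y) (tri_of A x z)"
    if "x \<in> carr A" "y \<in> carr A" "z \<in> carr A" for x y z
  proof -
    let ?\<rho> = "\<lambda>i::nat. if i = 0 then x else if i = 1 then y else z"
    have r: "range ?\<rho> \<subseteq> carr A" using that by auto
    have "\<forall>(s, t) \<in> rack_equations. eval A ?\<rho> s = eval A ?\<rho> t"
      using L r unfolding model_def rack_presentation_def by fastforce
    then show "tri_of A x (?g x y) = y" "?g x (tri_of A x y) = y"
      "tri_of A x (tri_of A y z) = tri_of A (tri_of A x y) (tri_of A x z)"
      by (auto simp: rack_equations_def tri_of_def)
  qed
  have b: "bij_betw (tri_of A x) (carr A) (carr A)" if "x \<in> carr A" for x
    by (rule bij_betw_byWitness[where f' = "?g x"]) (use cl eqs that in auto)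
  have "?g x y = inv_into (carr A) (tri_of A x) y" if "x \<in> carr A" "y \<in> carr A" for x y
    by (rule inv_into_f_eq[symmetric])
      (use bij_betw_imp_inj_on[OF b] cl[OF that] eqs that in simp_all)
  with b eqs(3) show ?R unfolding rack_def by blast
next
  assume R: ?R
  let ?g = "\<lambda>x y. interp A Untri [x, y]"
  from R have b: "bij_betw (tri_of A x) (carr A) (carr A)" if "x \<in> carr A" for x
    using that by (simp add: rack_def)
  have g: "?g x y = inv_into (carr A) (tri_of A x) y" if "x \<in> carr A" "y \<in> carr A" for x y
    using R that by blast
  have cl: "tri_of A x y \<in> carr A" "?g x y \<in> carr A" if "x \<in> carr A" "y \<in> carr A" for x y
    using b[OF that(1)] g[OF that] that by (auto simp: bij_betw_def inv_into_into)
  have eqs: "tri_of A x (?g x y) = y" "?g x (tri_of A x y) = y"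
    if "x \<in> carr A" "y \<in> carr A" for x y
    using bij_betw_inv_into_right[OF b] bij_betw_inv_into_left[OF b] g cl that by simp_all
  have ld: "tri_of A x (tri_of A y z) = tri_of A (tri_of A x y) (tri_of A x z)"
    if "x \<in> carr A" "y \<in> carr A" "z \<in> carr A" for x y z
    using R that by (auto simp: rack_def)
  have "interp A s xs \<in> carr A" if "length xs = 2" "set xs \<subseteq> carr A" for s xs
    using that by (rule binary_closed) (cases s; use cl in \<open>auto simp: tri_of_def\<close>)
  then show ?L
    unfolding model_def closed_algebra_def using eqs
    by (auto simp: rack_presentation_def rack_equations_def tri_of_def image_subset_iff
        intro: ld[unfolded tri_of_def])
qed

lemma model_quandle_iff:
  "model quandle_presentation A \<longleftrightarrow>
     quandle (carr A) (tri_of A) \<and>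
     (\<forall>x \<in> carr A. \<forall>y \<in> carr A. interp A Untri [x, y] = inv_into (carr A) (tri_of A x) y)"
proof -
  have "model quandle_presentation A \<longleftrightarrow> model rack_presentation A \<and>
      (\<forall>\<rho>::nat \<Rightarrow> 'a. range \<rho> \<subseteq> carr A \<longrightarrow> tri_of A (\<rho> 0) (\<rho> 0) = \<rho> 0)"
    by (auto simp: model_def closed_algebra_def quandle_presentation_def
        rack_presentation_def tri_of_def)
  also have "(\<forall>\<rho>::nat \<Rightarrow> 'a. range \<rho> \<subseteq> carr A \<longrightarrow> tri_of A (\<rho> 0) (\<rho> 0) = \<rho> 0)
      \<longleftrightarrow> (\<forall>x \<in> carr A. canonical (tri_of A) x = x)"
    (is "?A \<longleftrightarrow> ?B")
  proof
    assume ?A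
    then have "tri_of A x x = x" if "x \<in> carr A" for x
      using that by (elim allE[where x = "\<lambda>_. x"]) auto
    then show ?B by (simp add: canonical_def)
  qed (auto simp: canonical_def)
  finally show ?thesis by (auto simp: model_rack_iff quandle_def)
qed

lemma bij_canonical:
  assumes "rack R tri"
  shows "bij_betw (canonical tri) R R"
proof -
  have b: "bij_betw (tri x) R R" if "x \<in> R" for x
    using assms that by (simp add: rack_def)
  have cl: "tri x y \<in> R" if "x \<in> R" "y \<in> R" for x y
    using b[OF that(1)] that by (auto simp: bij_betw_def)
  have ld: "tri x (tri y z) = tri (tri x y) (tri x z)" if "x \<in> R" "y \<in> R" "z \<in> R" for x y z
    using assms that by (simp add: rack_def)
  have inj: "y = z" if "tri x y = tri x z" "x \<in> R" "y \<in> R" "z \<in> R" for x y z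
    using b[OF that(2)] that by (auto simp: bij_betw_def inj_on_def)
  have same: "tri (tri x x) z = tri x z" if "x \<in> R" "z \<in> R" for x z
  proof -
    obtain w where w: "w \<in> R" "z = tri x w"
      using b[OF \<open>x \<in> R\<close>] \<open>z \<in> R\<close> by (auto simp: bij_betw_def)
    then show ?thesis using ld[of x x w] that by simp
  qed
  have "inj_on (canonical tri) R"
  proof (rule inj_onI, unfold canonical_def)
    fix x y assume xy: "x \<in> R" "y \<in> R" "tri x x = tri y y"
    have "tri x x = tri (tri x x) y \<Longrightarrow> x = y"
      using same inj xy by metis
    moreover have "tri (tri x x) y = tri y y" using same xy by metis
    ultimately show "x = y" using xy by simp
  qed
  moreover have "\<exists>y \<in> R. tri y y = x" if "x \<in> R" for x
  proof -
    obtain y where y: "y \<in> R" "tri x y = x"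
      using bij_betw_imp_surj_on[OF b[OF \<open>x \<in> R\<close>]] \<open>x \<in> R\<close> by (metis imageE)
    have "tri y y = x"
    proof -
      have "tri x (tri y y) = tri x x" by (simp only: ld[OF that y(1) y(1)] y(2))
      then show ?thesis using inj cl y that by blast
    qed
    with y show ?thesis by blast
  qed
  ultimately show ?thesis
    using cl by (fastforce simp: bij_betw_def canonical_def)
qed


section \<open>Restriction along the morphisms of theories\<close>

lemma eval_in_carr:
  assumes "closed_algebra P A" "t \<in> terms P m" "\<And>i. i < m \<Longrightarrow> \<rho> i \<in> carr A"
  shows "eval A \<rho> t \<in> carr A"
  using assms(2)
proof induction
  case (Op f ts)
  then have "set (map (eval A \<rho>) ts) \<subseteq> carr A" by auto
  with Op assms(1) show ?case unfolding closed_algebra_def by simp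
qed (use assms in auto)

lemma eval_subst: "eval A \<rho> (subst \<sigma> t) = eval A (\<lambda>i. eval A \<rho> (\<sigma> i)) t"
  by (induction t) (simp_all cong: map_cong)

lemma eval_cong:
  assumes "t \<in> terms P m" "\<And>i. i < m \<Longrightarrow> \<rho> i = \<rho>' i"
  shows "eval A \<rho> t = eval A \<rho>' t"
  using assms(1) by induction (use assms(2) in \<open>auto cong: map_cong\<close>)

lemma eval_hom:
  assumes "closed_algebra P A" "model_hom P A B h" "t \<in> terms P m"
    "\<And>i. i < m \<Longrightarrow> \<rho> i \<in> carr A"
  shows "h (eval A \<rho> t) = eval B (\<lambda>i. h (\<rho> i)) t"
  using assms(3)
proof induction
  case (Op f ts)
  then have "set (map (eval A \<rho>) ts) \<subseteq> carr A"
    using eval_in_carr[OF assms(1)] assms(4) by auto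
  with Op assms(2) have "h (eval A \<rho> (Op f ts)) = interp B f (map h (map (eval A \<rho>) ts))"
    by (simp add: model_hom_def)
  with Op show ?case by (simp add: o_def cong: map_cong)
qed simp

lemma soundness:
  assumes "model P A" "\<And>i. i < m \<Longrightarrow> \<rho> i \<in> carr A" "provable P m s t"
  shows "eval A \<rho> s = eval A \<rho> t"
  using assms(3)
proof induction
  case (cong f ts us)
  then have "map (eval A \<rho>) ts = map (eval A \<rho>) us"
    by (auto simp: list_all2_conv_all_nth intro: nth_equalityI)
  then show ?case by (metis eval.simps(2))
next
  case (ax l r \<sigma>)
  have "range (\<lambda>i. eval A \<rho> (\<sigma> i)) \<subseteq> carr A"
    using ax assms(1,2) by (auto simp: model_def intro!: eval_in_carr)
  with ax assms(1) show ?case by (fastforce simp: eval_subst model_def)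
qed auto

lemma provable_rep:
  assumes "t \<in> terms P m"
  shows "provable P m t (rep (cls P m t))"
proof -
  have "t \<in> cls P m t" using assms by (simp add: cls_def provable.refl)
  then have "rep (cls P m t) \<in> cls P m t" unfolding rep_def by (rule someI)
  then show ?thesis by (simp add: cls_def)
qed

definition wf_presentation :: "'f presentation \<Rightarrow> bool" where
  "wf_presentation P \<longleftrightarrow> (\<forall>(l, r) \<in> equations P. \<exists>k. l \<in> terms P k \<and> r \<in> terms P k)"

lemma terms_intros:
  "i < m \<Longrightarrow> Var i \<in> terms P m"
  "Op f ts \<in> terms P m" if "f \<in> symbols P" "length ts = arity P f" "\<forall>t \<in> set ts. t \<in> terms P m"
  using that by (auto intro: terms.intros)

lemma terms_iff:
  "Var i \<in> terms P m \<longleftrightarrow> i < m"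
  "Op f ts \<in> terms P m \<longleftrightarrow> f \<in> symbols P \<and> length ts = arity P f \<and> (\<forall>t \<in> set ts. t \<in> terms P m)"
  by (subst terms.simps; simp)+

lemma wf_presentations:
  "wf_presentation set_presentation" "wf_presentation perm_presentation"
  "wf_presentation rack_presentation" "wf_presentation quandle_presentation"
proof -
  have wf: "wf_presentation P" if "\<forall>(l, r) \<in> equations P. l \<in> terms P 3 \<and> r \<in> terms P 3"
    for P :: "'f presentation"
    using that unfolding wf_presentation_def by blast
  show "wf_presentation set_presentation"
    by (simp add: wf_presentation_def set_presentation_def)
  show "wf_presentation perm_presentation"
    unfolding wf_presentation_def perm_presentation_def by (auto simp: terms_iff)
  show "wf_presentation rack_presentation" "wf_presentation quandle_presentation"
    by (rule wf, simp add: rack_presentation_def quandle_presentation_def rack_equations_def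
        terms_iff)+
qed

lemma subst_terms:
  assumes "t \<in> terms P k" "\<And>i. i < k \<Longrightarrow> \<sigma> i \<in> terms P m"
  shows "subst \<sigma> t \<in> terms P m"
  using assms(1) by induction (use assms(2) in \<open>auto intro!: terms_intros\<close>)

lemma provable_terms:
  assumes "wf_presentation P" "provable P m s t"
  shows "s \<in> terms P m \<and> t \<in> terms P m"
  using assms(2)
proof induction
  case (cong f ts us)
  then show ?case
    by (auto simp: list_all2_conv_all_nth in_set_conv_nth intro!: terms_intros)
next
  case (ax l r \<sigma>)
  then show ?case using assms(1)
    by (fastforce simp: wf_presentation_def intro: subst_terms)
qed auto

lemma cls_eqI: "provable P m s t \<Longrightarrow> cls P m s = cls P m t"
  by (auto simp: cls_def intro: provable.sym provable.trans)

lemma rep_terms: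
  assumes "wf_presentation P" "c \<in> carr (free_model P m)"
  shows "rep c \<in> terms P m" "cls P m (rep c) = c"
proof -
  obtain t where t: "c = cls P m t" "t \<in> terms P m"
    using assms(2) by (auto simp: free_model_def)
  then have "provable P m t (rep c)" using provable_rep by simp
  then show "rep c \<in> terms P m" "cls P m (rep c) = c"
    using provable_terms[OF assms(1)] cls_eqI t by blast+
qed

lemma closed_free_model:
  assumes "wf_presentation P"
  shows "closed_algebra P (free_model P m)"
  unfolding closed_algebra_def
proof (intro ballI allI impI)
  fix f cs assume *: "f \<in> symbols P" "length cs = arity P f \<and> set cs \<subseteq> carr (free_model P m)"
  then have "Op f (map rep cs) \<in> terms P m"
    by (auto intro!: terms_intros rep_terms(1)[OF assms])
  then show "interp (free_model P m) f cs \<in> carr (free_model P m)"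
    by (simp add: free_model_def)
qed

lemma eval_free_model:
  assumes "wf_presentation P" "t \<in> terms P k" "\<And>i. i < k \<Longrightarrow> \<rho> i \<in> carr (free_model P m)"
  shows "eval (free_model P m) \<rho> t = cls P m (subst (\<lambda>i. rep (\<rho> i)) t)"
  using assms(2)
proof induction
  case (Var i)
  then show ?case using rep_terms(2)[OF assms(1)] assms(3) by simp
next
  case (Op f ts)
  let ?\<sigma> = "\<lambda>i. rep (\<rho> i)"
  let ?us = "map (\<lambda>t. rep (cls P m (subst ?\<sigma> t))) ts"
  have st: "subst ?\<sigma> t \<in> terms P m" if "t \<in> set ts" for t
    by (rule subst_terms[where k = k]) (use Op that rep_terms(1)[OF assms(1)] assms(3) in auto)
  have "provable P m (Op f (map (subst ?\<sigma>) ts)) (Op f ?us)"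
    by (rule provable.cong)
      (use Op st in \<open>auto simp: list_all2_conv_all_nth intro!: provable_rep\<close>)
  moreover have "map rep (map (eval (free_model P m) \<rho>) ts) = ?us"
    using Op by auto
  ultimately show ?case
    by (simp add: free_model_def cls_eqI del: map_map)
qed

lemma model_free_model:
  assumes "wf_presentation P"
  shows "model P (free_model P m)"
proof -
  have "eval (free_model P m) \<rho> l = eval (free_model P m) \<rho> r"
    if e: "(l, r) \<in> equations P" and \<rho>: "range \<rho> \<subseteq> carr (free_model P m)" for l r \<rho>
  proof -
    obtain k where k: "l \<in> terms P k" "r \<in> terms P k"
      using assms e by (auto simp: wf_presentation_def)
    have "range (\<lambda>i. rep (\<rho> i)) \<subseteq> terms P m"
      using rep_terms(1)[OF assms] \<rho> by blast
    then have "provable P m (subst (\<lambda>i. rep (\<rho> i)) l) (subst (\<lambda>i. rep (\<rho> i)) r)"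
      by (rule provable.ax[OF e])
    then show ?thesis
      using \<rho> eval_free_model[OF assms k(1), of \<rho> m] eval_free_model[OF assms k(2), of \<rho> m]
      by (simp add: image_subset_iff cls_eqI)
  qed
  then show ?thesis using closed_free_model[OF assms] by (auto simp: model_def)
qed

lemma gens_nth: "i < m \<Longrightarrow> gens P m ! i = cls P m (Var i)"
  by (simp add: gens_def)

lemma gens_in_carr: "i < m \<Longrightarrow> gens P m ! i \<in> carr (free_model P m)"
  by (auto simp: gens_nth free_model_def intro: terms.intros)

lemma model_hom_from_free:
  assumes "wf_presentation P" "model P A" "\<And>i. i < m \<Longrightarrow> \<rho> i \<in> carr A"
  shows "model_hom P (free_model P m) A (\<lambda>c. eval A \<rho> (rep c))"
  unfolding model_hom_def
proof (intro conjI ballI allI impI)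
  show "(\<lambda>c. eval A \<rho> (rep c)) ` carr (free_model P m) \<subseteq> carr A"
    using assms(2,3) by (auto simp: model_def intro!: eval_in_carr rep_terms(1)[OF assms(1)])
  fix f cs assume *: "f \<in> symbols P" "length cs = arity P f \<and> set cs \<subseteq> carr (free_model P m)"
  then have "Op f (map rep cs) \<in> terms P m"
    by (auto intro!: terms_intros rep_terms(1)[OF assms(1)])
  then have "eval A \<rho> (Op f (map rep cs)) = eval A \<rho> (rep (cls P m (Op f (map rep cs))))"
    by (intro soundness[OF assms(2), of m] provable_rep assms(3))
  then show "eval A \<rho> (rep (interp (free_model P m) f cs))
      = interp A f (map (\<lambda>c. eval A \<rho> (rep c)) cs)"
    by (simp add: free_model_def o_def)
qed

text \<open>
  If \<open>G\<close> is a functor over the underlying sets from models of \<open>P'\<close> to models of \<open>P\<close>, then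
  \<open>G\<close> is restriction along \<open>morphism_of_right_adjoint P' G\<close>. Variables in
  HOL are monomorphic, so \<open>G\<close> is its instance at the free models and \<open>G'\<close> its instance at \<open>A\<close>.
\<close>

lemma act_morphism_of_right_adjoint:
  assumes wf: "wf_presentation P" "wf_presentation P'"
    and A: "model P' A"
    and G: "\<And>h. model_hom P' (free_model P' m) A h \<Longrightarrow> model_hom P (G (free_model P' m)) (G' A) h"
    and clo: "closed_algebra P (G (free_model P' m))"
    and carrier: "carr (G (free_model P' m)) = carr (free_model P' m)"
    and f: "f \<in> Hom (theory_of P) m n"
    and xs: "length xs = m" "set xs \<subseteq> carr A"
  shows "act A (morphism_of_right_adjoint P' G m n f) xs = act (G' A) f xs"
proof -
  let ?h = "\<lambda>c. eval A (\<lambda>i. xs ! i) (rep c)"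
  have x: "xs ! i \<in> carr A" if "i < m" for i using xs that by auto
  have hom: "model_hom P' (free_model P' m) A ?h"
    by (rule model_hom_from_free[OF wf(2) A x])
  have hg: "?h (gens P' m ! i) = xs ! i" if "i < m" for i
    using soundness[where \<rho> = "\<lambda>i. xs ! i", OF A x provable_rep[OF terms.Var[OF that]]] that by (simp add: gens_nth)
  have "?h (eval (G (free_model P' m)) (\<lambda>i. gens P' m ! i) (rep c))
      = eval (G' A) (\<lambda>i. xs ! i) (rep c)" if c: "c \<in> set f" for c
  proof -
    have t: "rep c \<in> terms P m"
      using rep_terms(1)[OF wf(1)] f c by (auto simp: theory_of_def)
    have "?h (eval (G (free_model P' m)) (\<lambda>i. gens P' m ! i) (rep c))
        = eval (G' A) (\<lambda>i. ?h (gens P' m ! i)) (rep c)"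
      by (rule eval_hom[OF clo G[OF hom] t]) (simp add: carrier gens_in_carr)
    also have "\<dots> = eval (G' A) (\<lambda>i. xs ! i) (rep c)"
      by (rule eval_cong[OF t hg])
    finally show ?thesis .
  qed
  then show ?thesis
    by (simp add: act_def morphism_of_right_adjoint_def)
qed

lemma model_hom_perm_algebra:
  assumes h: "h ` S \<subseteq> T" and f: "bij_betw f S S" and g: "bij_betw g T T"
    and comm: "\<And>x. x \<in> S \<Longrightarrow> h (f x) = g (h x)"
  shows "model_hom perm_presentation (perm_algebra S f) (perm_algebra T g) h"
proof -
  have "h (inv_into S f x) = inv_into T g (h x)" if "x \<in> S" for x
  proof -
    have y: "inv_into S f x \<in> S" "f (inv_into S f x) = x"
      using f that by (auto simp: bij_betw_def inv_into_into f_inv_into_f)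
    have "g (h (inv_into S f x)) = h x" using comm y by metis
    then show ?thesis using g h y by (metis bij_betw_inv_into_left image_subset_iff)
  qed
  then show ?thesis using h comm
    by (auto simp: model_hom_def perm_presentation_def perm_algebra_def length_Suc_conv
        split: perm_symbol.split)
qed

lemma closed_perm_algebra: "bij_betw f S S \<Longrightarrow> closed_algebra perm_presentation (perm_algebra S f)"
  by (auto simp: closed_algebra_def perm_presentation_def perm_algebra_def length_Suc_conv
      bij_betw_def inv_into_into split: perm_symbol.split)

theorem act_can_morphism:
  assumes "model rack_presentation A" "f \<in> Hom Perm m n" "length xs = m" "set xs \<subseteq> carr A"
  shows "act A (can_morphism m n f) xs = act (perm_algebra (carr A) (canonical (tri_of A))) f xs"
proof -
  let ?F = "free_model rack_presentation m"
  have F: "bij_betw (canonical (tri_of B)) (carr B) (carr B)" if "model rack_presentation B"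
    for B :: "(rack_symbol, 'c) algebra"
    using that by (simp add: model_rack_iff bij_canonical)
  note mF = model_free_model[OF wf_presentations(3), of m]
  have "act A (can_morphism m n f) xs = act (can_functor A) f xs"
    unfolding can_morphism_def
  proof (rule act_morphism_of_right_adjoint[OF wf_presentations(2,3) assms(1) _ _ _ assms(2-4)])
    show "closed_algebra perm_presentation (can_functor ?F)"
      by (simp add: can_functor_def closed_perm_algebra F mF)
    show "carr (can_functor ?F) = carr ?F"
      by (simp add: can_functor_def perm_algebra_def)
    fix h assume "model_hom rack_presentation ?F A h"
    then show "model_hom perm_presentation (can_functor ?F) (can_functor A) h"
      unfolding can_functor_def
      by (intro model_hom_perm_algebra F mF assms(1))
        (auto simp: model_hom_def rack_presentation_def canonical_def tri_of_def)
  qed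
  then show ?thesis by (simp add: can_functor_def)
qed

theorem act_id_morphism:
  fixes A :: "(unit, 'a) algebra"
  assumes "f \<in> Hom Perm m n" "length xs = m" "set xs \<subseteq> carr A"
  shows "act A (id_morphism m n f) xs = act (perm_algebra (carr A) (\<lambda>x. x)) f xs"
proof -
  let ?F = "free_model set_presentation m"
  have "act A (id_morphism m n f) xs = act (id_functor A) f xs"
    unfolding id_morphism_def
  proof (rule act_morphism_of_right_adjoint[OF wf_presentations(2,1) model_set_iff _ _ _ assms])
    have b: "bij_betw (\<lambda>x. x) S S" for S :: "'b set" by (simp add: bij_betw_def)
    show "closed_algebra perm_presentation (id_functor ?F)"
      by (simp add: id_functor_def closed_perm_algebra bij_betw_def)
    show "carr (id_functor ?F) = carr ?F"
      by (simp add: id_functor_def perm_algebra_def)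
    fix h assume "model_hom set_presentation ?F A h"
    then show "model_hom perm_presentation (id_functor ?F) (id_functor A) h"
      unfolding id_functor_def
      by (intro model_hom_perm_algebra) (auto simp: model_hom_def bij_betw_def)
  qed
  then show ?thesis by (simp add: id_functor_def)
qed

lemma interp_rack_algebra:
  assumes "model rack_presentation A" "length xs = 2" "set xs \<subseteq> carr A"
  shows "interp (rack_algebra (carr A) (tri_of A)) s xs = interp A s xs"
  using assms
  by (cases s) (auto simp: model_rack_iff rack_algebra_def tri_of_def length_Suc_conv
      numeral_2_eq_2)

lemma rack_signature:
  "symbols rack_presentation = UNIV" "arity rack_presentation s = 2"
  "symbols quandle_presentation = UNIV" "arity quandle_presentation s = 2"
  by (simp_all add: rack_presentation_def quandle_presentation_def)

lemma quandle_model_is_rack_model: "model quandle_presentation A \<Longrightarrow> model rack_presentation A"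
  by (simp add: model_quandle_iff model_rack_iff quandle_def)

theorem act_incl_morphism:
  assumes "model quandle_presentation A" "f \<in> Hom Rack m n" "length xs = m" "set xs \<subseteq> carr A"
  shows "act A (incl_morphism m n f) xs = act (rack_algebra (carr A) (tri_of A)) f xs"
proof -
  let ?F = "free_model quandle_presentation m"
  have ri: "interp (incl_functor B) s ys = interp B s ys"
    if "model quandle_presentation B" "length ys = 2" "set ys \<subseteq> carr B"
    for B :: "(rack_symbol, 'c) algebra" and s ys
    using that by (simp add: incl_functor_def interp_rack_algebra quandle_model_is_rack_model)
  have ci: "carr (incl_functor B) = carr B" for B :: "(rack_symbol, 'c) algebra"
    by (simp add: incl_functor_def rack_algebra_def)
  have ri': "interp (incl_functor A) s ys = interp A s ys"
    if "length ys = 2" "set ys \<subseteq> carr A" for s ys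
    using assms(1) that
    by (simp add: incl_functor_def interp_rack_algebra quandle_model_is_rack_model)
  have ci': "carr (incl_functor A) = carr A"
    by (simp add: incl_functor_def rack_algebra_def)
  note mF = model_free_model[OF wf_presentations(4), of m]
  have "act A (incl_morphism m n f) xs = act (incl_functor A) f xs"
    unfolding incl_morphism_def
  proof (rule act_morphism_of_right_adjoint[OF wf_presentations(3,4) assms(1) _ _ _ assms(2-4)])
    show "closed_algebra rack_presentation (incl_functor ?F)"
      using mF by (simp add: closed_algebra_def model_def rack_signature ri[OF mF] ci)
    show "carr (incl_functor ?F) = carr ?F" by (rule ci)
    fix h assume h: "model_hom quandle_presentation ?F A h"
    have "set (map h ys) \<subseteq> carr A" if "set ys \<subseteq> carr ?F" for ys
      using h that by (auto simp: model_hom_def)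
    with h show "model_hom rack_presentation (incl_functor ?F) (incl_functor A) h"
      by (simp add: model_hom_def rack_signature ri[OF mF] ri' ci ci')
  qed
  then show ?thesis by (simp add: incl_functor_def)
qed

theorem act_structure_morphism:
  assumes "wf_presentation P" "model P A" "f \<in> Hom Sets m n" "length xs = m" "set xs \<subseteq> carr A"
  shows "act A (structure_morphism P m n f) xs = act (set_algebra (carr A)) f xs"
proof -
  let ?F = "free_model P m"
  have "act A (structure_morphism P m n f) xs = act (underlying_functor A) f xs"
    unfolding structure_morphism_def
    by (rule act_morphism_of_right_adjoint[OF wf_presentations(1) assms(1,2) _ _ _ assms(3-5)])
      (auto simp: model_hom_def closed_algebra_def set_presentation_def underlying_functor_def
        set_algebra_def)
  then show ?thesis by (simp add: underlying_functor_def)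
qed

end

theory Submission
  imports Defs
begin

text \<open>
  Quandles are the racks satisfying one further equation \<open>x \<rhd> x = x\<close>, so \<open>Rack \<rightarrow> Quan\<close> is
  surjective on hom-sets, and a morphism \<open>u : Rack \<rightarrow> X\<close> factors through it iff \<open>u\<close> respects that
  equation. Now \<open>x \<rhd> x\<close> is the image under \<open>can\<close> of the generating operation of \<open>Perm\<close>, which
  \<open>id\<close> sends to the identity; so if \<open>u \<circ> can\<close> factors through \<open>id\<close>, then \<open>u\<close> respects it. The
  conditions concerning \<open>Sets\<close> hold because that theory is initial.
\<close>

section \<open>Theories and their morphisms\<close>

text \<open>Both arrows solve the tupling problem for the components of \<open>f\<close>, and that
  problem has a unique solution.\<close>

lemma lawvere_theory_eqI:
  assumes "lawvere_theory T" "f \<in> Hom T m n" "g \<in> Hom T m n"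
    and "\<And>i. i < n \<Longrightarrow> Comp T m n 1 (Proj T n i) f = Comp T m n 1 (Proj T n i) g"
  shows "f = g"
proof -
  interpret lawvere_theory T by fact
  have "\<exists>!h. h \<in> Hom T m n \<and> (\<forall>i<n. Comp T m n 1 (Proj T n i) h = Comp T m n 1 (Proj T n i) f)"
    by (rule tupling) (use assms(2) Comp_closed Proj_closed in blast)
  then show ?thesis using assms by metis
qed

lemma theory_morphismD:
  assumes "theory_morphism T T' \<phi>"
  shows "f \<in> Hom T m n \<Longrightarrow> \<phi> m n f \<in> Hom T' m n"
    and "\<phi> n n (Ident T n) = Ident T' n"
    and "\<lbrakk>f \<in> Hom T m n; g \<in> Hom T n k\<rbrakk>
      \<Longrightarrow> \<phi> m k (Comp T m n k g f) = Comp T' m n k (\<phi> n k g) (\<phi> m n f)"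
    and "i < n \<Longrightarrow> \<phi> n 1 (Proj T n i) = Proj T' n i"
  using assms by (simp_all add: theory_morphism_def)

lemma theory_morphism_comp:
  assumes "theory_morphism T T' \<phi>" "theory_morphism T' T'' \<psi>"
  shows "theory_morphism T T'' (\<psi> \<circ>\<circ> \<phi>)"
  using assms unfolding theory_morphism_def tmap_comp_def by simp

text \<open>Morphisms preserve composites and projections, so the components of an image are the
  images of the components. Comparing values thus reduces to arrows into the object 1.\<close>

lemma theory_morphism_values_eqI:
  assumes "lawvere_theory T" "lawvere_theory T'" "lawvere_theory X"
    and \<phi>: "theory_morphism T X \<phi>" and \<psi>: "theory_morphism T' X \<psi>"
    and f: "f \<in> Hom T m n" and g: "g \<in> Hom T' m n"
    and eq: "\<And>i. i < n \<Longrightarrow>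
      \<phi> m 1 (Comp T m n 1 (Proj T n i) f) = \<psi> m 1 (Comp T' m n 1 (Proj T' n i) g)"
  shows "\<phi> m n f = \<psi> m n g"
proof (rule lawvere_theory_eqI[OF assms(3)])
  show "\<phi> m n f \<in> Hom X m n" "\<psi> m n g \<in> Hom X m n"
    using theory_morphismD(1)[OF \<phi> f] theory_morphismD(1)[OF \<psi> g] by auto
  fix i assume i: "i < n"
  have "Proj T n i \<in> Hom T n 1" "Proj T' n i \<in> Hom T' n 1"
    using lawvere_theory.Proj_closed assms(1,2) i by blast+
  then show "Comp X m n 1 (Proj X n i) (\<phi> m n f) = Comp X m n 1 (Proj X n i) (\<psi> m n g)"
    using eq[OF i] theory_morphismD(3)[OF \<phi> f] theory_morphismD(3)[OF \<psi> g]
      theory_morphismD(4)[OF \<phi> i] theory_morphismD(4)[OF \<psi> i] by metis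
qed


section \<open>The theory of a presentation\<close>

lemma subst_cong:
  assumes "t \<in> terms P k" "\<And>i. i < k \<Longrightarrow> \<sigma> i = \<tau> i"
  shows "subst \<sigma> t = subst \<tau> t"
  using assms(1) by induction (use assms(2) in auto)

lemma subst_Var: "subst Var t = t"
  by (induction t) (simp_all add: map_idI)

lemma subst_subst: "subst \<sigma> (subst \<tau> t) = subst (\<lambda>i. subst \<sigma> (\<tau> i)) t"
  by (induction t) simp_all

lemma provable_subst:
  assumes "t \<in> terms P k" "\<And>i. i < k \<Longrightarrow> provable P m (\<sigma> i) (\<tau> i)"
  shows "provable P m (subst \<sigma> t) (subst \<tau> t)"
  using assms(1)
  by induction (use assms(2) in \<open>auto simp: list_all2_conv_all_nth intro!: provable.cong\<close>)

text \<open>Choosing representatives with \<open>rep\<close> allows every arrow to be handled as a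
  tuple of actual terms.\<close>

lemma Hom_theory_of:
  assumes "wf_presentation P"
  shows "f \<in> Hom (theory_of P) m n \<longleftrightarrow>
    (\<exists>ts. f = map (cls P m) ts \<and> length ts = n \<and> set ts \<subseteq> terms P m)"
proof
  assume f: "f \<in> Hom (theory_of P) m n"
  then have "cls P m (rep c) = c" "rep c \<in> terms P m" if "c \<in> set f" for c
    using that rep_terms[OF assms] by (auto simp: theory_of_def)
  then have "f = map (cls P m) (map rep f)" "set (map rep f) \<subseteq> terms P m"
    by (auto simp: map_idI)
  moreover have "length (map rep f) = n" using f by (simp add: theory_of_def)
  ultimately show "\<exists>ts. f = map (cls P m) ts \<and> length ts = n \<and> set ts \<subseteq> terms P m" by blast
qed (auto simp: theory_of_def free_model_def intro!: imageI)

lemma Hom_theory_ofE: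
  assumes "wf_presentation P" "f \<in> Hom (theory_of P) m n"
  obtains ts where "f = map (cls P m) ts" "length ts = n" "set ts \<subseteq> terms P m"
  using assms Hom_theory_of by blast

text \<open>By soundness, the value of a term in a model does not depend on the representative that
  \<open>rep\<close> picks from its class.\<close>

lemma act_cls:
  assumes "model P A" "length xs = m" "set xs \<subseteq> carr A" "set ts \<subseteq> terms P m"
  shows "act A (map (cls P m) ts) xs = map (eval A ((!) xs)) ts"
proof -
  have "eval A ((!) xs) (rep (cls P m t)) = eval A ((!) xs) t" if "t \<in> set ts" for t
    by (rule soundness[OF assms(1), symmetric, where m = m])
      (use assms that in \<open>auto intro!: provable_rep\<close>)
  then show ?thesis by (simp add: act_def)
qed

text \<open>Composition is defined by evaluation in the free model, which substitutes chosen
  representatives of the classes of \<open>ss\<close>. These are provably equal to the members of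
  \<open>ss\<close> themselves, so composition is simultaneous substitution.\<close>

lemma Comp_theory_of:
  assumes "wf_presentation P" "length ss = n" "set ss \<subseteq> terms P m" "set ts \<subseteq> terms P n"
  shows "Comp (theory_of P) m n k (map (cls P n) ts) (map (cls P m) ss) =
    map (cls P m) (map (subst ((!) ss)) ts)"
proof -
  have *: "ss ! i \<in> terms P m" if "i < n" for i using assms that by auto
  have "eval (free_model P m) ((!) (map (cls P m) ss)) t = cls P m (subst ((!) ss) t)"
    if "t \<in> set ts" for t
  proof -
    have t: "t \<in> terms P n" using assms that by auto
    have "eval (free_model P m) ((!) (map (cls P m) ss)) t =
        cls P m (subst (\<lambda>i. rep (map (cls P m) ss ! i)) t)"
      by (rule eval_free_model[OF assms(1) t])
        (use assms(2) * in \<open>auto simp: free_model_def\<close>)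
    also have "\<dots> = cls P m (subst ((!) ss) t)"
      by (rule cls_eqI, rule provable_subst[OF t])
        (use assms(2) * in \<open>auto intro!: provable.sym[OF provable_rep]\<close>)
    finally show ?thesis .
  qed
  moreover have "set (map (cls P m) ss) \<subseteq> carr (free_model P m)"
    using assms(3) by (auto simp: free_model_def)
  ultimately show ?thesis
    using act_cls[OF model_free_model[OF assms(1)], of "map (cls P m) ss" n m ts] assms
    by (simp add: theory_of_def)
qed

lemma Ident_theory_of: "Ident (theory_of P) n = map (cls P n) (map Var [0..<n])"
  by (simp add: theory_of_def gens_def)

lemma Proj_theory_of: "i < n \<Longrightarrow> Proj (theory_of P) n i = map (cls P n) [Var i]"
  by (simp add: theory_of_def gens_def)

lemma Comp_Proj_theory_of:
  assumes "wf_presentation P" "length ss = n" "set ss \<subseteq> terms P m" "i < n"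
  shows "Comp (theory_of P) m n 1 (Proj (theory_of P) n i) (map (cls P m) ss) = [cls P m (ss ! i)]"
  using Comp_theory_of[OF assms(1-3), of "[Var i]"] assms(4)
  by (simp add: Proj_theory_of terms_iff)

text \<open>On term tuples the category laws become laws of substitution: \<open>subst_Var\<close>
  gives the right unit and \<open>subst_subst\<close> associativity. Tupling is the formation of
  lists.\<close>

lemma lawvere_theory_of:
  assumes wf: "wf_presentation P"
  shows "lawvere_theory (theory_of P)"
proof
  note H = Hom_theory_of[OF wf] and E = Hom_theory_ofE[OF wf]
  have nth: "ts ! i \<in> terms P m" if "set ts \<subseteq> terms P m" "i < length ts" for ts m i
    using that by auto
  have st: "set (map (subst ((!) ss)) ts) \<subseteq> terms P m"
    if "set ss \<subseteq> terms P m" "set ts \<subseteq> terms P (length ss)" for ss ts m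
    using that nth by (auto intro!: subst_terms[where k = "length ss"])
  have Vars: "set (map Var [0..<n]) \<subseteq> terms P n" for n by (auto simp: terms_iff)
  show "Ident (theory_of P) n \<in> Hom (theory_of P) n n" for n
    unfolding H Ident_theory_of by (rule exI[of _ "map Var [0..<n]"]) (use Vars in auto)
  show "Proj (theory_of P) n i \<in> Hom (theory_of P) n 1" if "i < n" for n i
    unfolding H Proj_theory_of[OF that]
    by (rule exI[of _ "[Var i]"]) (use that in \<open>simp add: terms_iff\<close>)
  show "Proj (theory_of P) 1 0 = Ident (theory_of P) 1"
    by (simp add: Proj_theory_of Ident_theory_of)
  show "Comp (theory_of P) m n k g f \<in> Hom (theory_of P) m k"
    if f: "f \<in> Hom (theory_of P) m n" and g: "g \<in> Hom (theory_of P) n k" for f g m n k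
  proof -
    obtain ss where ss: "f = map (cls P m) ss" "length ss = n" "set ss \<subseteq> terms P m"
      by (rule E[OF f])
    obtain ts where ts: "g = map (cls P n) ts" "length ts = k" "set ts \<subseteq> terms P n"
      by (rule E[OF g])
    show ?thesis unfolding H ss(1) ts(1) Comp_theory_of[OF wf ss(2,3) ts(3)]
      by (rule exI, rule conjI[OF HOL.refl]) (use st ss ts in simp)
  qed
  show "Comp (theory_of P) m m n f (Ident (theory_of P) m) = f"
    if f: "f \<in> Hom (theory_of P) m n" for f m n
  proof -
    obtain ts where ts: "f = map (cls P m) ts" "length ts = n" "set ts \<subseteq> terms P m"
      by (rule E[OF f])
    have "subst ((!) (map Var [0..<m])) t = t" if "t \<in> set ts" for t
      using subst_cong[of t P m "(!) (map Var [0..<m])" Var] that ts(3) by (auto simp: subst_Var)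
    then show ?thesis
      unfolding ts(1) Ident_theory_of
      by (subst Comp_theory_of[OF wf _ Vars ts(3)]) (auto simp: map_idI)
  qed
  show "Comp (theory_of P) m n n (Ident (theory_of P) n) f = f"
    if f: "f \<in> Hom (theory_of P) m n" for f m n
  proof -
    obtain ts where ts: "f = map (cls P m) ts" "length ts = n" "set ts \<subseteq> terms P m"
      by (rule E[OF f])
    show ?thesis
      unfolding ts(1) Ident_theory_of Comp_theory_of[OF wf ts(2,3) Vars]
      using ts(2) by (auto intro!: nth_equalityI)
  qed
  show "Comp (theory_of P) m k l h (Comp (theory_of P) m n k g f) =
      Comp (theory_of P) m n l (Comp (theory_of P) n k l h g) f"
    if f: "f \<in> Hom (theory_of P) m n" and g: "g \<in> Hom (theory_of P) n k"
      and h: "h \<in> Hom (theory_of P) k l" for f g h m n k l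
  proof -
    obtain rs where rs: "f = map (cls P m) rs" "length rs = n" "set rs \<subseteq> terms P m"
      by (rule E[OF f])
    obtain ss where ss: "g = map (cls P n) ss" "length ss = k" "set ss \<subseteq> terms P n"
      by (rule E[OF g])
    obtain ts where ts: "h = map (cls P k) ts" "length ts = l" "set ts \<subseteq> terms P k"
      by (rule E[OF h])
    have 1: "set (map (subst ((!) rs)) ss) \<subseteq> terms P m" by (rule st) (use rs ss in auto)
    have 2: "set (map (subst ((!) ss)) ts) \<subseteq> terms P n" by (rule st) (use ss ts in auto)
    have l: "length (map (subst ((!) rs)) ss) = k" using ss by simp
    have "subst ((!) (map (subst ((!) rs)) ss)) t = subst ((!) rs) (subst ((!) ss) t)"
      if "t \<in> set ts" for t
      unfolding subst_subst by (rule subst_cong[where k = k and P = P]) (use ts ss that in auto)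
    then show ?thesis
      unfolding rs(1) ss(1) ts(1) Comp_theory_of[OF wf rs(2,3) ss(3)]
        Comp_theory_of[OF wf ss(2,3) ts(3)] Comp_theory_of[OF wf l 1 ts(3)]
        Comp_theory_of[OF wf rs(2,3) 2]
      by simp
  qed
  show "\<exists>!g. g \<in> Hom (theory_of P) m n \<and>
      (\<forall>i<n. Comp (theory_of P) m n 1 (Proj (theory_of P) n i) g = F i)"
    if F: "\<And>i. i < n \<Longrightarrow> F i \<in> Hom (theory_of P) m 1" for F m n
  proof -
    \<comment> \<open>An arrow into 1 is a one-element list, so each \<open>F i\<close> is given by
      a single term; the list of these terms is the required tuple.\<close>
    have "\<exists>t. F i = [cls P m t] \<and> t \<in> terms P m" if "i < n" for i
      using F[OF that] by (auto simp: H length_Suc_conv)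
    then obtain t where t: "F i = [cls P m (t i)]" "t i \<in> terms P m" if "i < n" for i
      by metis
    let ?ts = "map t [0..<n]"
    have ts: "length ?ts = n" "set ?ts \<subseteq> terms P m" using t(2) by auto
    show ?thesis
    proof (rule ex1I[of _ "map (cls P m) ?ts"], intro conjI allI impI)
      show "map (cls P m) ?ts \<in> Hom (theory_of P) m n" using ts H by blast
      show "Comp (theory_of P) m n 1 (Proj (theory_of P) n i) (map (cls P m) ?ts) = F i"
        if "i < n" for i
        using that by (subst Comp_Proj_theory_of[OF wf ts that]) (simp add: t(1))
    next
      fix g assume g: "g \<in> Hom (theory_of P) m n \<and>
        (\<forall>i<n. Comp (theory_of P) m n 1 (Proj (theory_of P) n i) g = F i)"
      then obtain us where us: "g = map (cls P m) us" "length us = n" "set us \<subseteq> terms P m"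
        using E by metis
      have "[cls P m (us ! i)] = F i" if "i < n" for i
        using g Comp_Proj_theory_of[OF wf us(2,3) that] that us(1) by simp
      then show "g = map (cls P m) ?ts"
        using us(1,2) t(1) by (auto intro!: nth_equalityI)
    qed
  qed
qed

lemma theory_of_values_eqI:
  assumes wf: "wf_presentation P" "wf_presentation P'" and X: "lawvere_theory X"
    and \<phi>: "theory_morphism (theory_of P) X \<phi>" and \<psi>: "theory_morphism (theory_of P') X \<psi>"
    and ts: "set ts \<subseteq> terms P m" and us: "set us \<subseteq> terms P' m"
    and eq: "list_all2 (\<lambda>t u. \<phi> m 1 [cls P m t] = \<psi> m 1 [cls P' m u]) ts us"
  shows "\<phi> m (length ts) (map (cls P m) ts) = \<psi> m (length ts) (map (cls P' m) us)"
proof (rule theory_morphism_values_eqI[OF lawvere_theory_of lawvere_theory_of X \<phi> \<psi>])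
  have l: "length us = length ts" using eq by (simp add: list_all2_lengthD)
  show "map (cls P m) ts \<in> Hom (theory_of P) m (length ts)"
    "map (cls P' m) us \<in> Hom (theory_of P') m (length ts)"
    using ts us l Hom_theory_of[OF wf(1)] Hom_theory_of[OF wf(2)] by blast+
  fix i assume "i < length ts"
  then show "\<phi> m 1 (Comp (theory_of P) m (length ts) 1 (Proj (theory_of P) (length ts) i)
        (map (cls P m) ts)) =
      \<psi> m 1 (Comp (theory_of P') m (length ts) 1 (Proj (theory_of P') (length ts) i)
        (map (cls P' m) us))"
    using Comp_Proj_theory_of[OF wf(1) HOL.refl ts] Comp_Proj_theory_of[OF wf(2) l us] eq
    by (simp add: list_all2_conv_all_nth)
qed (fact wf)+

text \<open>The uniqueness half of initiality: without operation symbols every term is a variable,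
  the class of a variable is a projection, and the images of projections are prescribed.\<close>

lemma Sets_initial:
  assumes X: "lawvere_theory X" and \<phi>: "theory_morphism Sets X \<phi>" and \<psi>: "theory_morphism Sets X \<psi>"
  shows "tmap_eq Sets \<phi> \<psi>"
  unfolding tmap_eq_def
proof (intro allI ballI)
  note wf = wf_presentations(1)
  fix m n f assume "f \<in> Hom Sets m n"
  then obtain ts where ts: "f = map (cls set_presentation m) ts" "length ts = n"
      "set ts \<subseteq> terms set_presentation m"
    by (rule Hom_theory_ofE[OF wf])
  have "\<phi> m 1 [cls set_presentation m t] = \<psi> m 1 [cls set_presentation m t]"
    if t: "t \<in> set ts" for t
  proof -
    have "t \<in> terms set_presentation m" using t ts by blast
    then obtain i where i: "t = Var i" "i < m"
      by cases (auto simp: set_presentation_def)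
    then show ?thesis
      using theory_morphismD(4)[OF \<phi>, of i m] theory_morphismD(4)[OF \<psi>, of i m]
      by (simp add: Proj_theory_of)
  qed
  then show "\<phi> m n f = \<psi> m n f"
    using theory_of_values_eqI[OF wf wf X \<phi> \<psi> ts(3,3)] ts(1,2)
    by (simp add: list_all2_same)
qed

section \<open>Functors over the underlying sets induce morphisms of theories\<close>

lemma gens_subset: "length (gens P m) = m" "set (gens P m) \<subseteq> carr (free_model P m)"
  by (auto simp: gens_def free_model_def intro!: imageI terms.Var)

text \<open>Identities and projections are preserved because evaluating a variable at the generators
  returns that generator. Preservation of composites is the statement that \<open>G\<close> is
  restriction along the induced map, applied to the free models themselves.\<close>

lemma theory_morphism_of_right_adjoint:
  assumes wf: "wf_presentation P" "wf_presentation P'"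
    and G: "\<And>m k h. model_hom P' (free_model P' m) (free_model P' k) h
      \<Longrightarrow> model_hom P (G (free_model P' m)) (G (free_model P' k)) h"
    and mod: "\<And>m. model P (G (free_model P' m))"
    and carrier: "\<And>m. carr (G (free_model P' m)) = carr (free_model P' m)"
  shows "theory_morphism (theory_of P) (theory_of P') (morphism_of_right_adjoint P' G)"
proof -
  let ?\<phi> = "morphism_of_right_adjoint P' G"
  let ?F = "free_model P'"
  have \<phi>: "?\<phi> m n (map (cls P m) ts) = map (eval (G (?F m)) ((!) (gens P' m))) ts"
    if "set ts \<subseteq> terms P m" for m n ts
    unfolding morphism_of_right_adjoint_def
    by (rule act_cls[OF mod gens_subset(1) _ that]) (simp add: carrier gens_subset)
  have clo: "closed_algebra P (G (?F m))" for m using mod by (simp add: model_def)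
  have ev: "eval (G (?F m)) ((!) (gens P' m)) t \<in> carr (?F m)" if "t \<in> terms P m" for m t
    using eval_in_carr[OF clo that] by (simp add: carrier gens_in_carr)
  show ?thesis
    unfolding theory_morphism_def
  proof (intro conjI allI ballI impI)
    show hom: "?\<phi> m n f \<in> Hom (theory_of P') m n" if f: "f \<in> Hom (theory_of P) m n" for m n f
    proof -
      obtain ts where ts: "f = map (cls P m) ts" "length ts = n" "set ts \<subseteq> terms P m"
        by (rule Hom_theory_ofE[OF wf(1) f])
      show ?thesis
        unfolding ts(1) \<phi>[OF ts(3)] using ts(2,3) by (auto simp: theory_of_def intro!: ev)
    qed
    show "?\<phi> n n (Ident (theory_of P) n) = Ident (theory_of P') n" for n
      unfolding Ident_theory_of
      by (subst \<phi>) (auto simp: terms_iff gens_nth)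
    show "?\<phi> n 1 (Proj (theory_of P) n i) = Proj (theory_of P') n i" if "i < n" for n i
      unfolding Proj_theory_of[OF that]
      by (subst \<phi>) (auto simp: terms_iff gens_nth that)
    fix m n k f g assume f: "f \<in> Hom (theory_of P) m n" and g: "g \<in> Hom (theory_of P) n k"
    obtain ss where ss: "f = map (cls P m) ss" "length ss = n" "set ss \<subseteq> terms P m"
      by (rule Hom_theory_ofE[OF wf(1) f])
    obtain ts where ts: "g = map (cls P n) ts" "length ts = k" "set ts \<subseteq> terms P n"
      by (rule Hom_theory_ofE[OF wf(1) g])
    have xs: "length (?\<phi> m n f) = n" "set (?\<phi> m n f) \<subseteq> carr (?F m)"
      using hom[OF f] by (auto simp: theory_of_def)
    have s: "set (map (subst ((!) ss)) ts) \<subseteq> terms P m"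
      using ss(2,3) ts(3) by (auto intro!: subst_terms[where k = n])
    have "Comp (theory_of P') m n k (?\<phi> n k g) (?\<phi> m n f) = act (?F m) (?\<phi> n k g) (?\<phi> m n f)"
      by (simp add: theory_of_def)
    \<comment> \<open>The restriction principle for the model \<open>?F m\<close>. It involves
      homomorphisms from \<open>?F n\<close> to \<open>?F m\<close> only, so one instance of
      \<open>G\<close> serves as both \<open>G\<close> and \<open>G'\<close>.\<close>
    also have "\<dots> = act (G (?F m)) g (?\<phi> m n f)"
      by (rule act_morphism_of_right_adjoint[where G = G and G' = G,
          OF wf model_free_model[OF wf(2)] G clo carrier g xs])
    also have "\<dots> = map (eval (G (?F m)) ((!) (?\<phi> m n f))) ts"
      unfolding ts(1) by (rule act_cls[OF mod xs(1) _ ts(3)]) (simp add: carrier xs(2))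
    \<comment> \<open>Evaluating at the values of \<open>ss\<close> is evaluating the substituted
      terms at the generators.\<close>
    also have "\<dots> = map (eval (G (?F m)) ((!) (gens P' m))) (map (subst ((!) ss)) ts)"
      unfolding ss(1) \<phi>[OF ss(3)]
      by (auto simp: eval_subst ss(2) intro!: eval_cong[where P = P and m = n] dest: subsetD[OF ts(3)])
    also have "\<dots> = ?\<phi> m k (Comp (theory_of P) m n k g f)"
      unfolding ss(1) ts(1) Comp_theory_of[OF wf(1) ss(2,3) ts(3)] by (rule \<phi>[OF s, symmetric])
    finally show "?\<phi> m k (Comp (theory_of P) m n k g f) =
        Comp (theory_of P') m n k (?\<phi> n k g) (?\<phi> m n f)" ..
  qed
qed


section \<open>The pushout square\<close>

lemma model_perm_algebra:
  assumes "bij_betw f S S"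
  shows "model perm_presentation (perm_algebra S f)"
  using assms by (simp add: model_perm_iff perm_algebra_def permutation_def)

lemma bij_canonical_of_model:
  "model rack_presentation A \<Longrightarrow> bij_betw (canonical (tri_of A)) (carr A) (carr A)"
  by (simp add: model_rack_iff bij_canonical)

text \<open>A rack homomorphism commutes with x \<rhd> x, hence with the canonical automorphism;
  compatibility with \<open>Unshift\<close> then follows from bijectivity through
  \<open>model_hom_perm_algebra\<close>.\<close>

lemma theory_morphism_can: "theory_morphism Perm Rack can_morphism"
  unfolding can_morphism_def
proof (rule theory_morphism_of_right_adjoint[OF wf_presentations(2,3)])
  note F = bij_canonical_of_model[OF model_free_model[OF wf_presentations(3)]]
  show "model perm_presentation (can_functor (free_model rack_presentation m))" for m
    by (simp add: can_functor_def model_perm_algebra F)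
  show "model_hom perm_presentation (can_functor (free_model rack_presentation m))
      (can_functor (free_model rack_presentation k)) h"
    if "model_hom rack_presentation (free_model rack_presentation m)
      (free_model rack_presentation k) h" for m k h
    unfolding can_functor_def
    by (intro model_hom_perm_algebra F)
      (use that in \<open>auto simp: model_hom_def rack_presentation_def canonical_def tri_of_def\<close>)
qed (simp add: can_functor_def perm_algebra_def)

lemma theory_morphism_id: "theory_morphism Perm Sets id_morphism"
  unfolding id_morphism_def
proof (rule theory_morphism_of_right_adjoint[OF wf_presentations(2,1)])
  show "model perm_presentation (id_functor (free_model set_presentation m))" for m
    by (simp add: id_functor_def model_perm_algebra bij_betw_def)
  show "model_hom perm_presentation (id_functor (free_model set_presentation m))
      (id_functor (free_model set_presentation k)) h"
    if "model_hom set_presentation (free_model set_presentation m)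
      (free_model set_presentation k) h" for m k h
    unfolding id_functor_def
    by (intro model_hom_perm_algebra) (use that in \<open>auto simp: model_hom_def bij_betw_def\<close>)
qed (simp add: id_functor_def perm_algebra_def)

lemma theory_morphism_structure:
  assumes "wf_presentation P"
  shows "theory_morphism Sets (theory_of P) (structure_morphism P)"
  unfolding structure_morphism_def
  by (rule theory_morphism_of_right_adjoint[OF wf_presentations(1) assms])
    (simp_all add: model_set_iff, simp_all add: model_hom_def set_presentation_def
      underlying_functor_def set_algebra_def)

lemma carr_incl_functor: "carr (incl_functor A) = carr A"
  by (simp add: incl_functor_def rack_algebra_def)

lemma tri_of_incl_functor: "tri_of (incl_functor A) = tri_of A"
  by (intro ext) (simp add: incl_functor_def rack_algebra_def tri_of_def)

text \<open>\<open>incl_functor\<close> rebuilds \<open>Untri\<close> from \<open>Tri\<close> by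
  \<open>inv_into\<close>. In a model this agrees with the given inverse on arguments from the
  carrier.\<close>

lemma interp_incl_functor:
  assumes "model quandle_presentation A" "length xs = 2" "set xs \<subseteq> carr A"
  shows "interp (incl_functor A) s xs = interp A s xs"
  using assms by (simp add: incl_functor_def interp_rack_algebra quandle_model_is_rack_model)

lemma model_incl_functor:
  assumes "model quandle_presentation A"
  shows "model rack_presentation (incl_functor A)"
proof -
  have "interp (incl_functor A) Untri [x, y] = inv_into (carr A) (tri_of A x) y" for x y
    by (simp add: incl_functor_def rack_algebra_def)
  then show ?thesis
    using assms by (simp add: model_quandle_iff model_rack_iff quandle_def carr_incl_functor
      tri_of_incl_functor)
qed

lemma theory_morphism_incl: "theory_morphism Rack Quan incl_morphism"
  unfolding incl_morphism_def
proof (rule theory_morphism_of_right_adjoint[OF wf_presentations(3,4)])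
  note F = model_free_model[OF wf_presentations(4)]
  show "model rack_presentation (incl_functor (free_model quandle_presentation m))" for m
    by (rule model_incl_functor[OF F])
  show "model_hom rack_presentation (incl_functor (free_model quandle_presentation m))
      (incl_functor (free_model quandle_presentation k)) h"
    if h: "model_hom quandle_presentation (free_model quandle_presentation m)
      (free_model quandle_presentation k) h" for m k h
  proof -
    have "set (map h ys) \<subseteq> carr (free_model quandle_presentation k)"
      if "set ys \<subseteq> carr (free_model quandle_presentation m)" for ys
      using h that by (auto simp: model_hom_def)
    with h show ?thesis
      by (simp add: model_hom_def rack_signature interp_incl_functor[OF F] carr_incl_functor)
  qed
qed (rule carr_incl_functor)

text \<open>The presentations share symbols and arities and differ in their equations alone, so one
  term can represent arrows of both theories.\<close>

lemma terms_quandle_eq_rack: "terms quandle_presentation m = terms rack_presentation m"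
proof -
  have "t \<in> terms quandle_presentation m \<longleftrightarrow> t \<in> terms rack_presentation m" for t
    by (induction t) (auto simp: terms_iff rack_signature)
  then show ?thesis by blast
qed

text \<open>The morphism passes from classes modulo rack equations to classes modulo quandle
  equations without changing the terms. This is what makes it surjective on hom-sets.\<close>

lemma incl_morphism_cls:
  assumes ts: "set ts \<subseteq> terms rack_presentation m"
  shows "incl_morphism m n (map (cls rack_presentation m) ts) =
    map (cls quandle_presentation m) ts"
proof -
  let ?F = "free_model quandle_presentation m" and ?x = "(!) (gens quandle_presentation m)"
  note F = model_free_model[OF wf_presentations(4), of m]
  have eval: "eval (incl_functor ?F) ?x t = cls quandle_presentation m t"
    if t: "t \<in> terms rack_presentation m" for t
  proof -
    \<comment> \<open>All intermediate values stay in the carrier, where the two interpretations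
      agree.\<close>
    have "eval (incl_functor ?F) ?x t = eval ?F ?x t"
      using t
    proof induction
      case (Op s ss)
      have "set (map (eval ?F ?x) ss) \<subseteq> carr ?F"
        using Op(3) F by (auto simp: model_def terms_quandle_eq_rack gens_in_carr
          intro!: eval_in_carr[where P = quandle_presentation and m = m])
      moreover have "map (eval (incl_functor ?F) ?x) ss = map (eval ?F ?x) ss"
        using Op by simp
      moreover have "length ss = 2" using Op by (simp add: rack_signature)
      ultimately show ?case using interp_incl_functor[OF F] by (simp del: map_eq_conv)
    qed simp
    also have "\<dots> = cls quandle_presentation m (subst (\<lambda>i. rep (?x i)) t)"
      by (rule eval_free_model[OF wf_presentations(4), where k = m])
        (use t in \<open>auto simp: terms_quandle_eq_rack gens_in_carr\<close>)
    \<comment> \<open>The representative of each generator is provably equal to the corresponding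
      variable.\<close>
    also have "\<dots> = cls quandle_presentation m (subst Var t)"
      by (rule cls_eqI, rule provable_subst[where k = m])
        (use t in \<open>auto simp: terms_quandle_eq_rack gens_nth terms_iff
          intro!: provable.sym[OF provable_rep]\<close>)
    finally show ?thesis by (simp add: subst_Var)
  qed
  have "incl_morphism m n (map (cls rack_presentation m) ts) = map (eval (incl_functor ?F) ?x) ts"
    unfolding incl_morphism_def morphism_of_right_adjoint_def
    by (rule act_cls[OF model_incl_functor[OF F] gens_subset(1) _ ts])
      (simp add: carr_incl_functor gens_subset)
  then show ?thesis using eval ts by auto
qed

section \<open>The generating permutation and commutativity of the square\<close>

lemma can_morphism_Shift:
  "can_morphism 1 1 [cls perm_presentation 1 (Op Shift [Var 0])] =
    [cls rack_presentation 1 (Op Tri [Var 0, Var 0])]"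
proof -
  let ?F = "free_model rack_presentation 1"
  note wf = wf_presentations(3)
  have "can_morphism 1 1 (map (cls perm_presentation 1) [Op Shift [Var 0]]) =
      map (eval (can_functor ?F) ((!) (gens rack_presentation 1))) [Op Shift [Var 0]]"
    unfolding can_morphism_def morphism_of_right_adjoint_def
  proof (rule act_cls)
    show "model perm_presentation (can_functor ?F)"
      unfolding can_functor_def
      by (intro model_perm_algebra bij_canonical_of_model model_free_model wf)
    show "set (gens rack_presentation 1) \<subseteq> carr (can_functor ?F)"
      using gens_subset(2)[of rack_presentation 1] by (simp add: can_functor_def perm_algebra_def)
  qed (simp_all add: gens_subset terms_iff perm_presentation_def)
  also have "\<dots> = [eval ?F ((!) (gens rack_presentation 1)) (Op Tri [Var 0, Var 0])]"
    by (simp add: can_functor_def perm_algebra_def canonical_def tri_of_def)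
  \<comment> \<open>The generator of the free rack is the identity arrow
    \<open>[cls rack_presentation 1 (Var 0)]\<close>, so the evaluation can be read as a composite
    and computed by substitution.\<close>
  also have "\<dots> = Comp Rack 1 1 1 (map (cls rack_presentation 1) [Op Tri [Var 0, Var 0]])
      (map (cls rack_presentation 1) [Var 0])"
    using act_cls[OF model_free_model[OF wf], of "gens rack_presentation 1" 1 1
        "[Op Tri [Var 0, Var 0]]"] gens_subset[of rack_presentation 1]
    by (simp add: theory_of_def terms_iff rack_signature gens_def)
  also have "\<dots> = map (cls rack_presentation 1) (map (subst ((!) [Var 0])) [Op Tri [Var 0, Var 0]])"
    by (rule Comp_theory_of[OF wf]) (simp_all add: terms_iff rack_signature)
  finally show ?thesis by simp
qed

lemma id_morphism_Shift:
  "id_morphism 1 1 [cls perm_presentation 1 (Op Shift [Var 0])] = Ident Sets 1"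
proof -
  let ?F = "free_model set_presentation 1"
  have "id_morphism 1 1 (map (cls perm_presentation 1) [Op Shift [Var 0]]) =
      map (eval (id_functor ?F) ((!) (gens set_presentation 1))) [Op Shift [Var 0]]"
    unfolding id_morphism_def morphism_of_right_adjoint_def
  proof (rule act_cls)
    show "model perm_presentation (id_functor ?F)"
      unfolding id_functor_def by (rule model_perm_algebra) (simp add: bij_betw_def)
    show "set (gens set_presentation 1) \<subseteq> carr (id_functor ?F)"
      using gens_subset(2)[of set_presentation 1] by (simp add: id_functor_def perm_algebra_def)
  qed (simp_all add: gens_subset terms_iff perm_presentation_def)
  then show ?thesis
    by (simp add: id_functor_def perm_algebra_def theory_of_def gens_def)
qed

text \<open>Both composites evaluate the terms of \<open>f\<close> at the generators of the free
  quandle, with \<open>Shift\<close> read as the canonical map on one side and as the identity on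
  the other. In a quandle these maps coincide.\<close>

lemma square_commutes:
  "tmap_eq Perm (incl_morphism \<circ>\<circ> can_morphism)
    (structure_morphism quandle_presentation \<circ>\<circ> id_morphism)"
  unfolding tmap_eq_def tmap_comp_def
proof (intro allI ballI)
  fix m n f assume f: "f \<in> Hom Perm m n"
  let ?F = "free_model quandle_presentation m" and ?x = "gens quandle_presentation m"
  let ?A = "perm_algebra (carr ?F) (canonical (tri_of ?F))"
  let ?B = "perm_algebra (carr ?F) (\<lambda>x. x)"
  note F = model_free_model[OF wf_presentations(4), of m]
  obtain ts where ts: "f = map (cls perm_presentation m) ts" "length ts = n"
      "set ts \<subseteq> terms perm_presentation m"
    by (rule Hom_theory_ofE[OF wf_presentations(2) f])
  have x: "set ?x \<subseteq> carr (incl_functor ?F)" "set ?x \<subseteq> carr (underlying_functor ?F)"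
    by (simp_all add: carr_incl_functor underlying_functor_def set_algebra_def gens_subset)
  have can: "canonical (tri_of ?F) x = x" if "x \<in> carr ?F" for x
    using F that by (simp add: model_quandle_iff quandle_def)
  then have bij: "bij_betw (canonical (tri_of ?F)) (carr ?F) (carr ?F)"
    by (simp add: bij_betw_def inj_on_def)
  \<comment> \<open>The two maps are known to agree on the carrier only, so the algebras are
    compared by the identity homomorphism and \<open>eval_hom\<close> rather than by
    equality.\<close>
  have AB: "model_hom perm_presentation ?A ?B (\<lambda>x. x)"
    by (rule model_hom_perm_algebra[OF _ bij]) (auto simp: can bij_betw_def)
  have carr: "carr ?A = carr ?F" "carr ?B = carr ?F" by (simp_all add: perm_algebra_def)
  have "incl_morphism m n (can_morphism m n f) = act (incl_functor ?F) (can_morphism m n f) ?x"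
    by (simp add: incl_morphism_def morphism_of_right_adjoint_def)
  also have "\<dots> = act ?A f ?x"
    using act_can_morphism[OF model_incl_functor[OF F] f gens_subset(1) x(1)]
    by (simp add: carr_incl_functor tri_of_incl_functor)
  also have "\<dots> = map (eval ?A ((!) ?x)) ts"
    unfolding ts(1)
    by (rule act_cls[OF model_perm_algebra[OF bij] gens_subset(1) _ ts(3)])
      (simp add: carr gens_subset)
  also have "\<dots> = map (eval ?B ((!) ?x)) ts"
    using eval_hom[OF closed_perm_algebra[OF bij] AB, of _ m "(!) ?x"] ts(3)
    by (auto simp: carr gens_in_carr)
  also have "\<dots> = act ?B f ?x"
    unfolding ts(1)
    by (rule act_cls[OF model_perm_algebra gens_subset(1) _ ts(3), symmetric])
      (simp_all add: carr gens_subset bij_betw_def)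
  also have "\<dots> = act (underlying_functor ?F) (id_morphism m n f) ?x"
    using act_id_morphism[OF f gens_subset(1) x(2)]
    by (simp add: underlying_functor_def set_algebra_def)
  also have "\<dots> = structure_morphism quandle_presentation m n (id_morphism m n f)"
    by (simp add: structure_morphism_def morphism_of_right_adjoint_def)
  finally show "incl_morphism m n (can_morphism m n f) =
    structure_morphism quandle_presentation m n (id_morphism m n f)" .
qed

section \<open>The universal property\<close>

text \<open>Induction on derivations: rack axioms already hold between rack classes, the idempotence
  axiom comes from \<open>uv\<close> at the generator of \<open>Perm\<close>, and congruence holds
  because \<open>u\<close> preserves composites and tuples.\<close>

lemma quandle_provable_respected:
  assumes X: "lawvere_theory X" and u: "theory_morphism Rack X u" and v: "theory_morphism Sets X v"
    and uv: "tmap_eq Perm (u \<circ>\<circ> can_morphism) (v \<circ>\<circ> id_morphism)"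
    and "provable quandle_presentation m s t"
  shows "u m 1 [cls rack_presentation m s] = u m 1 [cls rack_presentation m t]"
  using assms(5)
proof induction
  let ?R = rack_presentation
  note wf = wf_presentations(3)
  case (cong f ts us)
  have l: "length ts = 2" "length us = 2"
    using cong by (auto simp: rack_signature list_all2_lengthD[symmetric])
  have mem: "set ts \<subseteq> terms ?R m" "set us \<subseteq> terms ?R m"
    using cong(3)
    by (auto simp: list_all2_conv_all_nth in_set_conv_nth
      dest!: provable_terms[OF wf_presentations(4), unfolded terms_quandle_eq_rack])
  \<comment> \<open>The symbol itself as an arrow from 2 to 1; every term with head \<open>f\<close>
    is the composite of this arrow with the pair of its arguments.\<close>
  let ?o = "[Op f [Var 0, Var 1]]"
  have o: "set ?o \<subseteq> terms ?R 2" "map (cls ?R 2) ?o \<in> Hom Rack 2 1"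
    unfolding Hom_theory_of[OF wf]
    by (auto simp: terms_iff rack_signature intro!: exI[of _ ?o])
  have comp: "u m 1 [cls ?R m (Op f ss)] =
      Comp X m 2 1 (u 2 1 (map (cls ?R 2) ?o)) (u m 2 (map (cls ?R m) ss))"
    if ss: "length ss = 2" "set ss \<subseteq> terms ?R m" for ss
  proof -
    have "map (subst ((!) ss)) ?o = [Op f ss]"
      using ss(1) by (auto simp: length_Suc_conv numeral_2_eq_2)
    then have "[cls ?R m (Op f ss)] = Comp Rack m 2 1 (map (cls ?R 2) ?o) (map (cls ?R m) ss)"
      using Comp_theory_of[OF wf ss o(1), of 1] by simp
    moreover have "map (cls ?R m) ss \<in> Hom Rack m 2" using ss Hom_theory_of[OF wf] by blast
    ultimately show ?thesis using theory_morphismD(3)[OF u _ o(2)] by metis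
  qed
  have "u m (length ts) (map (cls ?R m) ts) = u m (length ts) (map (cls ?R m) us)"
    by (rule theory_of_values_eqI[OF wf wf X u u mem])
      (rule list_all2_mono[OF cong(3)], simp)
  then show ?case using comp[OF l(1) mem(1)] comp[OF l(2) mem(2)] l by simp
next
  let ?R = rack_presentation
  note wf = wf_presentations(3)
  case (ax l r \<sigma>)
  then have \<sigma>: "range \<sigma> \<subseteq> terms ?R m" by (simp add: terms_quandle_eq_rack)
  show ?case
  proof (cases "(l, r) \<in> rack_equations")
    case True
    then have "provable ?R m (subst \<sigma> l) (subst \<sigma> r)"
      by (intro provable.ax \<sigma>) (simp add: rack_presentation_def)
    then show ?thesis by (simp add: cls_eqI)
  next
    case False
    then have lr: "l = Op Tri [Var 0, Var 0]" "r = Var 0"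
      using ax by (auto simp: quandle_presentation_def)
    have shift: "[cls perm_presentation 1 (Op Shift [Var 0])] \<in> Hom Perm 1 1"
      unfolding Hom_theory_of[OF wf_presentations(2)]
      by (auto simp: terms_iff perm_presentation_def intro!: exI[of _ "[Op Shift [Var 0]]"])
    \<comment> \<open>Commutation at \<open>Shift\<close>: \<open>can_morphism\<close> sends it to x
      \<rhd> x and \<open>id_morphism\<close> to the identity, which \<open>v\<close>
      preserves.\<close>
    have idem: "u 1 1 [cls ?R 1 (Op Tri [Var 0, Var 0])] = Ident X 1"
    proof -
      have "u 1 1 (can_morphism 1 1 [cls perm_presentation 1 (Op Shift [Var 0])]) =
          v 1 1 (id_morphism 1 1 [cls perm_presentation 1 (Op Shift [Var 0])])"
        using uv shift unfolding tmap_eq_def tmap_comp_def by blast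
      then show ?thesis
        unfolding can_morphism_Shift id_morphism_Shift theory_morphismD(2)[OF v] .
    qed
    have s: "[cls ?R m (\<sigma> 0)] \<in> Hom Rack m 1"
      unfolding Hom_theory_of[OF wf] using \<sigma> by (intro exI[of _ "[\<sigma> 0]"]) auto
    have o: "[cls ?R 1 (Op Tri [Var 0, Var 0])] \<in> Hom Rack 1 1"
      unfolding Hom_theory_of[OF wf]
      by (auto simp: terms_iff rack_signature intro!: exI[of _ "[Op Tri [Var 0, Var 0]]"])
    \<comment> \<open>An arbitrary instance of the axiom is the generic one precomposed with the
      arrow \<open>\<sigma> 0\<close>.\<close>
    have "[cls ?R m (subst \<sigma> l)] =
        Comp Rack m 1 1 [cls ?R 1 (Op Tri [Var 0, Var 0])] [cls ?R m (\<sigma> 0)]"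
      using Comp_theory_of[OF wf, of "[\<sigma> 0]" 1 m "[Op Tri [Var 0, Var 0]]" 1] \<sigma> lr
      by (simp add: terms_iff rack_signature image_subset_iff)
    then have "u m 1 [cls ?R m (subst \<sigma> l)] = Comp X m 1 1 (Ident X 1) (u m 1 [cls ?R m (\<sigma> 0)])"
      using theory_morphismD(3)[OF u s o] idem by simp
    also have "\<dots> = u m 1 [cls ?R m (\<sigma> 0)]"
      by (rule lawvere_theory.Ident_Comp[OF X theory_morphismD(1)[OF u s]])
    finally show ?thesis by (simp add: lr)
  qed
qed auto

text \<open>The factorization lifts a quandle class to a term, takes the rack class of that term and
  applies \<open>u\<close>; \<open>resp\<close> makes the result independent of the lift.\<close>

lemma factor_through_quandles:
  assumes X: "lawvere_theory X" and u: "theory_morphism Rack X u"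
    and resp: "\<And>m s t. provable quandle_presentation m s t
      \<Longrightarrow> u m 1 [cls rack_presentation m s] = u m 1 [cls rack_presentation m t]"
  shows "\<exists>w. theory_morphism Quan X w \<and> tmap_eq Rack (w \<circ>\<circ> incl_morphism) u"
proof -
  let ?R = rack_presentation and ?Q = quandle_presentation
  note wfR = wf_presentations(3) and wfQ = wf_presentations(4)
  define w where "w = (\<lambda>m n f. u m n (map (\<lambda>c. cls ?R m (rep c)) f))"
  \<comment> \<open>Independence of the lift: any term may replace the one chosen by
    \<open>rep\<close>, since the two are provably equal in the quandle theory.\<close>
  have w: "w m (length ts) (map (cls ?Q m) ts) = u m (length ts) (map (cls ?R m) ts)"
    if ts: "set ts \<subseteq> terms ?R m" for m ts
  proof -
    have p: "provable ?Q m t (rep (cls ?Q m t))" if "t \<in> set ts" for t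
      using ts that by (auto simp: terms_quandle_eq_rack intro!: provable_rep)
    let ?us = "map (\<lambda>t. rep (cls ?Q m t)) ts"
    have "u m (length ts) (map (cls ?R m) ts) = u m (length ts) (map (cls ?R m) ?us)"
    proof (rule theory_of_values_eqI[OF wfR wfR X u u ts])
      show "set ?us \<subseteq> terms ?R m"
        using p provable_terms[OF wfQ] by (auto simp: terms_quandle_eq_rack)
      show "list_all2 (\<lambda>t s. u m 1 [cls ?R m t] = u m 1 [cls ?R m s]) ts ?us"
        using p resp by (auto simp: list_all2_conv_all_nth)
    qed
    then show ?thesis by (simp add: w_def o_def)
  qed
  have H: "map (cls ?R m) ts \<in> Hom Rack m (length ts)" if "set ts \<subseteq> terms ?R m" for m ts
    using that Hom_theory_of[OF wfR] by blast
  have "theory_morphism Quan X w"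
    unfolding theory_morphism_def
  proof (intro conjI allI ballI impI)
    show "w m n f \<in> Hom X m n" if f: "f \<in> Hom Quan m n" for m n f
    proof -
      obtain ts where ts: "f = map (cls ?Q m) ts" "length ts = n" "set ts \<subseteq> terms ?Q m"
        by (rule Hom_theory_ofE[OF wfQ f])
      then show ?thesis using w[of ts m] theory_morphismD(1)[OF u H, of ts m]
        by (simp add: terms_quandle_eq_rack)
    qed
    show "w n n (Ident Quan n) = Ident X n" for n
      using w[of "map Var [0..<n]" n] theory_morphismD(2)[OF u, of n]
      by (simp add: Ident_theory_of terms_iff image_subset_iff)
    show "w n 1 (Proj Quan n i) = Proj X n i" if "i < n" for n i
      using w[of "[Var i]" n] theory_morphismD(4)[OF u that] that
      by (simp add: Proj_theory_of terms_iff)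
    fix m n k f g assume f: "f \<in> Hom Quan m n" and g: "g \<in> Hom Quan n k"
    obtain ss where ss: "f = map (cls ?Q m) ss" "length ss = n" "set ss \<subseteq> terms ?Q m"
      by (rule Hom_theory_ofE[OF wfQ f])
    obtain ts where ts: "g = map (cls ?Q n) ts" "length ts = k" "set ts \<subseteq> terms ?Q n"
      by (rule Hom_theory_ofE[OF wfQ g])
    note R = ss(3)[unfolded terms_quandle_eq_rack] ts(3)[unfolded terms_quandle_eq_rack]
    have s: "set (map (subst ((!) ss)) ts) \<subseteq> terms ?R m"
      using ss(2) R by (auto intro!: subst_terms[where k = n])
    have "w m k (Comp Quan m n k g f) = u m k (map (cls ?R m) (map (subst ((!) ss)) ts))"
      unfolding ss(1) ts(1) Comp_theory_of[OF wfQ ss(2,3) ts(3)]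
      using w[OF s] ts(2) by simp
    \<comment> \<open>Composites in both theories are the same substitution of terms, so
      functoriality of \<open>w\<close> is inherited from \<open>u\<close>.\<close>
    also have "\<dots> = u m k (Comp Rack m n k (map (cls ?R n) ts) (map (cls ?R m) ss))"
      by (simp only: Comp_theory_of[OF wfR ss(2) R])
    also have "\<dots> = Comp X m n k (w n k g) (w m n f)"
      using theory_morphismD(3)[OF u H[OF R(1), unfolded ss(2)] H[OF R(2), unfolded ts(2)]]
        w[OF R(1)] w[OF R(2)] ss(1,2) ts(1,2) by simp
    finally show "w m k (Comp Quan m n k g f) = Comp X m n k (w n k g) (w m n f)" .
  qed
  moreover have "tmap_eq Rack (w \<circ>\<circ> incl_morphism) u"
    unfolding tmap_eq_def tmap_comp_def
  proof (intro allI ballI)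
    fix m n f assume f: "f \<in> Hom Rack m n"
    obtain ts where ts: "f = map (cls ?R m) ts" "length ts = n" "set ts \<subseteq> terms ?R m"
      by (rule Hom_theory_ofE[OF wfR f])
    then show "w m n (incl_morphism m n f) = u m n f"
      using w[OF ts(3)] by (simp add: incl_morphism_cls)
  qed
  ultimately show ?thesis by blast
qed

text \<open>Every arrow of \<open>Quan\<close> is the image of the arrow of \<open>Rack\<close>
  given by the same terms.\<close>

lemma incl_morphism_epi:
  assumes "tmap_eq Rack (w \<circ>\<circ> incl_morphism) (w' \<circ>\<circ> incl_morphism)"
  shows "tmap_eq Quan w w'"
  unfolding tmap_eq_def
proof (intro allI ballI)
  fix m n f assume f: "f \<in> Hom Quan m n"
  obtain ts where ts: "f = map (cls quandle_presentation m) ts" "length ts = n"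
      "set ts \<subseteq> terms rack_presentation m"
    using Hom_theory_ofE[OF wf_presentations(4) f] by (metis terms_quandle_eq_rack)
  then have "map (cls rack_presentation m) ts \<in> Hom Rack m n"
    using Hom_theory_of[OF wf_presentations(3)] by blast
  then show "w m n f = w' m n f"
    using assms unfolding ts(1) tmap_eq_def tmap_comp_def
    by (simp flip: incl_morphism_cls[OF ts(3), of n])
qed

theorem theorem6p1:
  shows "pushout_square TYPE('x) Perm Rack Sets Quan
           can_morphism id_morphism incl_morphism (structure_morphism quandle_presentation)"
  unfolding pushout_square_def
proof (intro conjI allI impI)
  note b = theory_morphism_structure[OF wf_presentations(4)]
  fix X :: "'x lawvere" and u v
  assume "lawvere_theory X \<and> theory_morphism Rack X u \<and> theory_morphism Sets X v \<and>
    tmap_eq Perm (u \<circ>\<circ> can_morphism) (v \<circ>\<circ> id_morphism)"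
  then have X: "lawvere_theory X" and u: "theory_morphism Rack X u"
    and v: "theory_morphism Sets X v"
    and uv: "tmap_eq Perm (u \<circ>\<circ> can_morphism) (v \<circ>\<circ> id_morphism)"
    by blast+
  obtain w where w: "theory_morphism Quan X w" "tmap_eq Rack (w \<circ>\<circ> incl_morphism) u"
    using factor_through_quandles[OF X u quandle_provable_respected[OF X u v uv]] by blast
  \<comment> \<open>Both sides are morphisms out of the initial theory.\<close>
  have "tmap_eq Sets (w \<circ>\<circ> structure_morphism quandle_presentation) v"
    by (rule Sets_initial[OF X theory_morphism_comp[OF b w(1)] v])
  \<comment> \<open>Both \<open>w'\<close> and \<open>w\<close> restrict to \<open>u\<close> along
    the epimorphism \<open>incl_morphism\<close>.\<close>
  moreover have "tmap_eq Quan w' w" if "tmap_eq Rack (w' \<circ>\<circ> incl_morphism) u" for w'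
    by (rule incl_morphism_epi) (use that w(2) in \<open>simp add: tmap_eq_def\<close>)
  ultimately show "\<exists>w. theory_morphism Quan X w \<and> tmap_eq Rack (w \<circ>\<circ> incl_morphism) u \<and>
      tmap_eq Sets (w \<circ>\<circ> structure_morphism quandle_presentation) v \<and>
      (\<forall>w'. theory_morphism Quan X w' \<and> tmap_eq Rack (w' \<circ>\<circ> incl_morphism) u \<and>
        tmap_eq Sets (w' \<circ>\<circ> structure_morphism quandle_presentation) v \<longrightarrow> tmap_eq Quan w' w)"
    using w by blast
qed (fact lawvere_theory_of[OF wf_presentations(1)] lawvere_theory_of[OF wf_presentations(2)]
  lawvere_theory_of[OF wf_presentations(3)] lawvere_theory_of[OF wf_presentations(4)]
  theory_morphism_can theory_morphism_id theory_morphism_incl square_commutes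
  theory_morphism_structure[OF wf_presentations(4)])+

end
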